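(* Let $\Lambda$ be a class of measurable functions such that for each $\lambda\in\Lambda$, $\lambda(X)$ is continuous with a density function (under $P$) bounded by $M>0$. Let $\mathcal{T}$ be a class of functions of bounded variation that take values in $[-M,M]$. Then for the class $\mathcal{G}\equiv\{\tau\circ\lambda:(\tau,\lambda)\in\mathcal{T}\times\Lambda\}$, it is satisfied that for any $q\ge1$, $$\log N_{[\cdot]}(C_2\varepsilon,\mathcal{G},L_q(P))\le\log N(\varepsilon^q,\Lambda,\|\cdot\|_\infty)+C_1/\varepsilon,$$ where $C_1$ and $C_2$ are positive constants depending only on $q$ and $M$.
   Context: $X$ is a random vector in $\mathbf{R}^{d_X}$ with distribution $P$, and $\Lambda$ consists of real-valued functions on $\mathbf{R}^{d_X}$; $\mathcal{T}$ consists of real functions of a real variable. $\|\cdot\|_\infty$ is the sup norm. $N(\varepsilon,\mathcal{F},\|\cdot\|_\infty)$ is the $\varepsilon$-covering number of $\mathcal{F}$ with respect to $\|\cdot\|_\infty$ and $N_{[\cdot]}(\varepsilon,\mathcal{F},L_q(P))$ is the $\varepsilon$-bracketing number of $\mathcal{F}$ with respect to the $L_q(P)$-norm (van der Vaart–Wellner definitions). The inequality is for $\varepsilon>0$.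
   Formalization: The functions in T are assumed to have total variation uniformly bounded by some V, and the constants C1, C2 depend on q, M and V; without a uniform bound the claim is false (e.g. T the Rademacher step functions, Λ a single function with λ(X) uniform on [0,1]). *)

theory Defs
  imports "HOL-Probability.Probability"
begin

text \<open>
  The constants in the theorem may depend neither on the dimension nor on the distribution, so the
  dimension has to be quantified inside the statement. The space of real vectors of dimension
  \<open>d\<close> is therefore the set of extensional functions on \<open>{..<d}\<close>. The product
  sigma-algebra below is its Borel sigma-algebra.
\<close>

abbreviation borel_vec :: "nat \<Rightarrow> (nat \<Rightarrow> real) measure" where
  "borel_vec d \<equiv> Pi\<^sub>M {..<d} (\<lambda>_. borel)"

definition sup_norm :: "'a set \<Rightarrow> ('a \<Rightarrow> real) \<Rightarrow> ennreal" where
  "sup_norm S f = (SUP x\<in>S. ennreal \<bar>f x\<bar>)"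

definition Lq_space :: "real \<Rightarrow> 'a measure \<Rightarrow> ('a \<Rightarrow> real) set" where
  "Lq_space q P = {f \<in> borel_measurable P. integrable P (\<lambda>x. \<bar>f x\<bar> powr q)}"

definition Lq_norm :: "real \<Rightarrow> 'a measure \<Rightarrow> ('a \<Rightarrow> real) \<Rightarrow> real" where
  "Lq_norm q P f = (\<integral>x. \<bar>f x\<bar> powr q \<partial>P) powr (1 / q)"

text \<open>
  Covering and bracketing numbers follow van der Vaart and Wellner (Weak Convergence and Empirical
  Processes, Section 2.1.1): balls are open, centers and brackets need not belong to the class but
  have finite norm, brackets have size strictly less than \<open>\<epsilon>\<close>, and a bracket contains the
  functions lying between its ends at every point. The value is \<open>\<infinity>\<close> (the infimum of
  the empty set) if no finite cover exists.
\<close>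

definition covering_number_sup :: "'a set \<Rightarrow> real \<Rightarrow> ('a \<Rightarrow> real) set \<Rightarrow> enat" where
  "covering_number_sup S \<epsilon> F =
     (INF A \<in> {A. finite A \<and> (\<forall>c\<in>A. sup_norm S c < \<infinity>) \<and>
                  (\<forall>f\<in>F. \<exists>c\<in>A. sup_norm S (\<lambda>x. f x - c x) < ennreal \<epsilon>)}.
        enat (card A))"

definition bracketing_number_Lq ::
  "real \<Rightarrow> 'a measure \<Rightarrow> real \<Rightarrow> ('a \<Rightarrow> real) set \<Rightarrow> enat" where
  "bracketing_number_Lq q P \<epsilon> F =
     (INF B \<in> {B. finite B \<and>
                  (\<forall>(l, u)\<in>B. l \<in> Lq_space q P \<and> u \<in> Lq_space q P \<and>
                             Lq_norm q P (\<lambda>x. u x - l x) < \<epsilon>) \<and>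
                  (\<forall>f\<in>F. \<exists>(l, u)\<in>B. \<forall>x\<in>space P. l x \<le> f x \<and> f x \<le> u x)}.
        enat (card B))"

text \<open>The logarithm is extended by \<open>log 0 = -\<infinity>\<close> and \<open>log \<infinity> = \<infinity>\<close>;
  the value 0 is taken only for an empty class.\<close>

definition ln_enat :: "enat \<Rightarrow> ereal" where
  "ln_enat n = (case n of enat k \<Rightarrow> (if k = 0 then -\<infinity> else ereal (ln (real k))) | \<infinity> \<Rightarrow> \<infinity>)"

text \<open>
  Variation over the whole real line. The theorem needs a uniform bound \<open>V\<close> on the
  variations of the outer functions: if only each variation is finite, the bracketing numbers can be
  infinite while the covering number is 1 (identity inner function, uniform distribution on the
  unit interval).
\<close>

definition total_variation :: "(real \<Rightarrow> real) \<Rightarrow> ennreal" where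
  "total_variation \<tau> =
     (SUP (n, t) \<in> {(n, t). mono (t :: nat \<Rightarrow> real)}.
        ennreal (\<Sum>i<n. \<bar>\<tau> (t (Suc i)) - \<tau> (t i)\<bar>))"

definition has_density_bounded_by :: "'a measure \<Rightarrow> ('a \<Rightarrow> real) \<Rightarrow> real \<Rightarrow> bool" where
  "has_density_bounded_by P \<phi> M \<longleftrightarrow>
     (\<exists>p. distributed P lborel \<phi> p \<and> (\<forall>y. p y \<le> ennreal M))"

end

theory Submission
  imports Defs
begin

text \<open>
  A function of variation at most \<open>V\<close> is a difference of two monotone functions, so the outer
  functions reduce to monotone ones. If \<open>\<psi>\<close> is within \<open>c = 2 \<epsilon>\<^sup>q\<close> of
  \<open>\<phi>\<close> and \<open>f\<close> is monotone, then \<open>f \<circ> \<phi>\<close> lies between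
  \<open>f (\<psi> - c)\<close> and \<open>f (\<psi> + c)\<close>; by Fubini these differ in mean by
  \<open>O(c)\<close>, because \<open>\<psi>\<close> has a bounded density. It remains to bracket monotone functions
  of \<open>\<psi>\<close>, that is, after the quantile transform, monotone functions on the unit interval.
  Such a function is approximated on a dyadic partition that is refined only where the function
  increases much (Birman and Solomjak): \<open>O(1/\<epsilon>)\<close> cells suffice, and recording the
  refinement tree and the increments takes \<open>O(1/\<epsilon>)\<close> bits. One tree is used for each of
  the two ends and each of the two monotone parts, and the centre \<open>\<psi>\<close> is chosen from a cover.
\<close>

subsection \<open>Adaptive dyadic partitions\<close>

text \<open>
  A tree encodes a dyadic partition of \<open>[a, a + h)\<close>; a leaf carries the increment of
  \<open>\<lfloor>g\<rfloor>\<close> over its cell. The lower bracket is measured relative to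
  \<open>\<lfloor>g a\<rfloor>\<close>, and \<open>cost\<close> is the integral of the \<open>q\<close>-th power of the
  gap between the brackets.
\<close>

datatype dyadic = Leaf nat | Node dyadic dyadic

text \<open>One unit per node of the tree plus the sum of the increments: the length of
  \<open>code\<close> up to a factor 2.\<close>

primrec weight :: "dyadic \<Rightarrow> nat" where
  "weight (Leaf n) = Suc n"
| "weight (Node s t) = Suc (weight s + weight t)"

primrec rise :: "dyadic \<Rightarrow> nat" where
  "rise (Leaf n) = n"
| "rise (Node s t) = rise s + rise t"

primrec lower :: "dyadic \<Rightarrow> real \<Rightarrow> real \<Rightarrow> real \<Rightarrow> real" where
  "lower (Leaf n) a h y = 0"
| "lower (Node s t) a h y =
     (if y < a + h / 2 then lower s a (h / 2) y else real (rise s) + lower t (a + h / 2) (h / 2) y)"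

primrec gap :: "dyadic \<Rightarrow> real \<Rightarrow> real \<Rightarrow> real \<Rightarrow> real" where
  "gap (Leaf n) a h y = real (Suc n)"
| "gap (Node s t) a h y =
     (if y < a + h / 2 then gap s a (h / 2) y else gap t (a + h / 2) (h / 2) y)"

primrec cost :: "real \<Rightarrow> dyadic \<Rightarrow> real \<Rightarrow> real" where
  "cost q (Leaf n) h = h * real (Suc n) powr q"
| "cost q (Node s t) h = cost q s (h / 2) + cost q t (h / 2)"

primrec fits :: "(real \<Rightarrow> real) \<Rightarrow> dyadic \<Rightarrow> real \<Rightarrow> real \<Rightarrow> bool" where
  "fits g (Leaf n) a h \<longleftrightarrow> \<lfloor>g (a + h)\<rfloor> = \<lfloor>g a\<rfloor> + int n"
| "fits g (Node s t) a h \<longleftrightarrow> fits g s a (h / 2) \<and> fits g t (a + h / 2) (h / 2)"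

text \<open>Preorder listing with the increments in unary. Unary is affordable because the
  increments add up to the total rise, which is of the same order as the permitted number of
  cells.\<close>

primrec code :: "dyadic \<Rightarrow> bool list" where
  "code (Leaf n) = False # replicate n True @ [False]"
| "code (Node s t) = True # code s @ code t"

section \<open>Counting trees through a prefix-free binary code\<close>

lemma replicate_True_False_eq:
  "replicate m True @ False # xs = replicate n True @ False # ys \<Longrightarrow> m = n \<and> xs = ys"
proof (induction m arbitrary: n)
  case 0
  then show ?case by (cases n) auto
next
  case (Suc m)
  then show ?case by (cases n) auto
qed

text \<open>A preorder code shows where its tree ends, so it can be read off any longer list. The
  arbitrary tails are what the induction needs: in a \<open>Node\<close> the code of the left
  subtree is followed by that of the right one.\<close>

lemma code_prefix_free: "code s @ xs = code t @ ys \<Longrightarrow> s = t \<and> xs = ys"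
proof (induction s arbitrary: t xs ys)
  case (Leaf n)
  show ?case
  proof (cases t)
    case (Leaf m)
    then show ?thesis
      using Leaf.prems replicate_True_False_eq[of n xs m ys] by simp
  next
    case (Node t1 t2)
    then show ?thesis using Leaf.prems by simp
  qed
next
  case (Node s1 s2)
  show ?case
  proof (cases t)
    case (Leaf m)
    then show ?thesis using Node.prems by simp
  next
    case (Node t1 t2)
    then have "code s1 @ code s2 @ xs = code t1 @ code t2 @ ys"
      using Node.prems by simp
    then show ?thesis using Node.IH(1)[of "code s2 @ xs" t1 "code t2 @ ys"] Node.IH(2)[of xs t2 ys] Node
      by simp
  qed
qed

lemma inj_code: "inj code"
  using code_prefix_free[of _ "[]" _ "[]"] by (intro injI) simp

lemma length_code: "length (code t) \<le> 2 * weight t"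
  by (induction t) auto

text \<open>Trees inject into the bit strings of length at most \<open>2 * m\<close>, which a
  geometric sum counts.\<close>

lemma finite_card_weight_le:
  shows "finite {t. weight t \<le> m}" and "card {t. weight t \<le> m} \<le> 2 ^ (2 * m + 1)"
proof -
  let ?L = "{xs :: bool list. length xs \<le> 2 * m}"
  have L: "finite ?L" using finite_lists_length_le[of "UNIV :: bool set"] by simp
  have sub: "code ` {t. weight t \<le> m} \<subseteq> ?L"
  proof clarify
    fix t assume "weight t \<le> m"
    then show "length (code t) \<le> 2 * m" using length_code[of t] by linarith
  qed
  have inj: "inj_on code {t. weight t \<le> m}" using inj_code by (rule inj_on_subset) simp
  show "finite {t. weight t \<le> m}"
    using finite_imageD[OF finite_subset[OF sub L] inj] .
  have "card {t. weight t \<le> m} \<le> card ?L" using card_inj_on_le[OF inj sub L] .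
  also have "card ?L = (\<Sum>i\<le>2 * m. 2 ^ i)"
    using card_lists_length_le[of "UNIV :: bool set" "2 * m"] by simp
  also have "\<dots> \<le> 2 ^ (2 * m + 1)"
  proof -
    have "(\<Sum>i<Suc k. (2::nat) ^ i) \<le> 2 ^ Suc k" for k by (induction k) auto
    then show ?thesis by (simp add: lessThan_Suc_atMost)
  qed
  finally show "card {t. weight t \<le> m} \<le> 2 ^ (2 * m + 1)" .
qed

section \<open>What a fitting tree says about the function it encodes\<close>

lemma fits_floor: "fits g t a h \<Longrightarrow> \<lfloor>g (a + h)\<rfloor> = \<lfloor>g a\<rfloor> + int (rise t)"
proof (induction t arbitrary: a h)
  case (Node s t)
  have "\<lfloor>g (a + h / 2)\<rfloor> = \<lfloor>g a\<rfloor> + int (rise s)"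
    using Node.IH(1)[of a "h / 2"] Node.prems by simp
  moreover have "\<lfloor>g (a + h / 2 + h / 2)\<rfloor> = \<lfloor>g (a + h / 2)\<rfloor> + int (rise t)"
    using Node.IH(2)[of "a + h / 2" "h / 2"] Node.prems by (simp only: fits.simps)
  moreover have "a + h / 2 + h / 2 = a + h" by simp
  ultimately show ?case by simp
qed simp

text \<open>The witnesses are the ends of the leaf cell containing \<open>y\<close>. The bounds are
  stated at these ends because the encoded function will later be comparable with the bracketed one
  only at points up to \<open>y\<close> or strictly beyond it.\<close>

lemma fits_sound:
  assumes "fits g t a h" "a \<le> y" "y < a + h"
  shows "\<exists>a' b'. a' \<le> y \<and> y < b' \<and> of_int \<lfloor>g a\<rfloor> + lower t a h y \<le> g a' \<and>
    g b' \<le> of_int \<lfloor>g a\<rfloor> + lower t a h y + gap t a h y"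
  using assms
proof (induction t arbitrary: a h)
  case (Leaf n)
  show ?case
  proof (intro exI conjI)
    show "a \<le> y" "y < a + h" using Leaf by auto
    show "of_int \<lfloor>g a\<rfloor> + lower (Leaf n) a h y \<le> g a" by simp
    \<comment> \<open>Rounding down loses less than 1, which is why the gap of a leaf is its
      increment plus one.\<close>
    have "g (a + h) \<le> of_int \<lfloor>g (a + h)\<rfloor> + 1" by linarith
    then show "g (a + h) \<le> of_int \<lfloor>g a\<rfloor> + lower (Leaf n) a h y + gap (Leaf n) a h y"
      using Leaf.prems(1) by (simp add: algebra_simps)
  qed
next
  case (Node s t)
  show ?case
  proof (cases "y < a + h / 2")
    case True
    then show ?thesis using Node.IH(1)[of a "h / 2"] Node.prems by simp
  next
    case False
    have "\<lfloor>g (a + h / 2)\<rfloor> = \<lfloor>g a\<rfloor> + int (rise s)"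
      using fits_floor[of g s a "h / 2"] Node.prems by simp
    then have e: "real_of_int \<lfloor>g (a + h / 2)\<rfloor> = of_int \<lfloor>g a\<rfloor> + real (rise s)" by simp
    show ?thesis using False Node.IH(2)[of "a + h / 2" "h / 2"] Node.prems
      unfolding e by (simp add: add.assoc)
  qed
qed

section \<open>Existence of trees with few nodes and small cost\<close>

definition chain_const :: "real \<Rightarrow> real" where
  "chain_const q = 1 / (1 - (1 / 2) powr (1 / q))"

text \<open>The constant is the sum of the geometric series with ratio
  \<open>(1 / 2) powr (1 / q)\<close>, the factor by which halving a cell shrinks the potential. By
  the second identity, the potential multiplied by \<open>chain_const q\<close> drops at a split by
  exactly the potential of the cell.\<close>

lemma chain_const:
  assumes "q > 0"
  shows "chain_const q > 0" and "chain_const q * (1 - (1 / 2) powr (1 / q)) = 1"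
proof -
  have "(1 / 2) powr (1 / q) < (1::real)" using powr_less_mono2[of "1 / q" "1 / 2" 1] assms by simp
  then show "chain_const q > 0" "chain_const q * (1 - (1 / 2) powr (1 / q)) = 1"
    by (auto simp: chain_const_def)
qed

text \<open>The sum is at most twice the larger term, and the other power is nonnegative.\<close>

lemma add_powr_le:
  fixes x y q :: real
  assumes "x \<ge> 0" "y \<ge> 0" "q > 0"
  shows "(x + y) powr q \<le> (2 * x) powr q + (2 * y) powr q"
proof (cases "x \<le> y")
  case True
  then have "(x + y) powr q \<le> (2 * y) powr q" using assms by (intro powr_mono2) auto
  then show ?thesis by (simp add: add_increasing)
next
  case False
  then have "(x + y) powr q \<le> (2 * x) powr q" using assms by (intro powr_mono2) auto
  then show ?thesis by (simp add: add_increasing2)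
qed

text \<open>
  A cell is split as long as \<open>h N \<delta>\<^sup>q > 1\<close>, where \<open>\<delta>\<close> is the increase of
  \<open>g\<close> over it. The potential \<open>\<delta> (h N) powr (1 / q)\<close> then exceeds 1, and halving
  \<open>h\<close> while distributing \<open>\<delta>\<close> loses a fixed fraction of it, so it pays for all splits.
\<close>

lemma adaptive_dyadic:
  assumes g: "mono g" and q: "q > 0" and N: "N > 0"
    and "h > 0" "g (a + h) - g a \<le> N" "h * N * N powr q \<le> 2 ^ n"
  shows "\<exists>t. fits g t a h \<and>
    real (weight t) \<le> 1 + real (rise t) + 2 * (chain_const q * (g (a + h) - g a) * (h * N) powr (1 / q)) \<and>
    cost q t h \<le> 4 powr q * h + 2 powr q / N * (1 + chain_const q * (g (a + h) - g a) * (h * N) powr (1 / q))"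
  using assms(4-)
proof (induction n arbitrary: a h)
  let ?D = "chain_const q"
  have D: "?D > 0" using chain_const q by simp
  have stop: "\<exists>t. fits g t a h \<and>
      real (weight t) \<le> 1 + real (rise t) + 2 * (?D * (g (a + h) - g a) * (h * N) powr (1 / q)) \<and>
      cost q t h \<le> 4 powr q * h + 2 powr q / N * (1 + ?D * (g (a + h) - g a) * (h * N) powr (1 / q))"
    if h: "h > 0" and s: "h * N * (g (a + h) - g a) powr q \<le> 1" for a h
  proof -
    let ?d = "g (a + h) - g a"
    have d: "?d \<ge> 0" using g h by (simp add: monoD)
    define n where "n = nat (\<lfloor>g (a + h)\<rfloor> - \<lfloor>g a\<rfloor>)"
    have n: "int n = \<lfloor>g (a + h)\<rfloor> - \<lfloor>g a\<rfloor>" using d by (simp add: n_def floor_mono)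
    have P: "?D * ?d * (h * N) powr (1 / q) \<ge> 0" using D d by simp
    \<comment> \<open>One unit comes from \<open>Suc\<close>, the other from replacing values by
      floors.\<close>
    have n2: "real (Suc n) \<le> ?d + 2"
    proof -
      have "real_of_int (int n) = of_int \<lfloor>g (a + h)\<rfloor> - of_int \<lfloor>g a\<rfloor>" by (simp only: n of_int_diff)
      then show ?thesis by simp linarith
    qed
    have "h * real (Suc n) powr q \<le> h * (?d + 2) powr q"
      using h q n2 by (intro mult_left_mono powr_mono2) auto
    \<comment> \<open>The part with the increase is at most \<open>2 powr q / N\<close> by the
      stopping criterion; the summand 2, due to rounding, costs \<open>4 powr q * h\<close>.\<close>
    also have "\<dots> \<le> h * ((2 * ?d) powr q + (2 * 2) powr q)"
      using h q d add_powr_le[of ?d 2 q] by (intro mult_left_mono) auto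
    also have "\<dots> = 2 powr q / N * (h * N * ?d powr q) + 4 powr q * h"
      using N d powr_mult[of 2 ?d q] by (simp add: algebra_simps)
    also have "\<dots> \<le> 2 powr q / N * 1 + 4 powr q * h"
      using s N by (intro add_right_mono mult_left_mono) auto
    also have "\<dots> \<le> 4 powr q * h + 2 powr q / N * (1 + ?D * ?d * (h * N) powr (1 / q))"
    proof -
      have "2 powr q / N * 1 \<le> 2 powr q / N * (1 + ?D * ?d * (h * N) powr (1 / q))"
        using P N by (intro mult_left_mono) auto
      then show ?thesis by linarith
    qed
    finally have c: "cost q (Leaf n) h \<le> \<dots>" by simp
    show ?thesis
      by (rule exI[of _ "Leaf n"]) (use n P c in auto)
  qed
  {
    case 0
    \<comment> \<open>The bound by \<open>2 ^ n\<close> is fuel for the induction: each halving uses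
      up one unit of \<open>n\<close>, and at \<open>n = 0\<close> the stopping criterion holds
      because the increase is at most \<open>N\<close>.\<close>
    have "g (a + h) - g a \<ge> 0" using g 0 by (simp add: monoD)
    then have "(g (a + h) - g a) powr q \<le> N powr q" using 0 q by (intro powr_mono2) auto
    then have "h * N * (g (a + h) - g a) powr q \<le> h * N * N powr q"
      using 0 N by (intro mult_left_mono) auto
    also have "\<dots> \<le> 1" using 0 by simp
    finally show ?case using 0 by (intro stop)
  next
    case (Suc n)
    let ?d = "g (a + h) - g a"
    show ?case
    proof (cases "h * N * ?d powr q \<le> 1")
      case True
      then show ?thesis using Suc.prems by (intro stop) auto
    next
      case False
      define m where "m = a + h / 2"
      define d1 where "d1 = g m - g a"
      define d2 where "d2 = g (a + h) - g m"
      define r where "r = (h * N) powr (1 / q)"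
      have mh: "m + h / 2 = a + h" by (simp add: m_def)
      have d: "d1 \<ge> 0" "d2 \<ge> 0" "d1 + d2 = ?d" "?d \<le> N"
        using g Suc.prems by (auto simp: monoD m_def d1_def d2_def)
      have r': "(h / 2 * N) powr (1 / q) = (1 / 2) powr (1 / q) * r"
        unfolding r_def by (subst powr_mult[symmetric]) (use Suc.prems N in auto)
      have "1 powr (1 / q) < (h * N * ?d powr q) powr (1 / q)"
        using False q by (intro powr_less_mono2) auto
      also have "\<dots> = r * ?d"
        unfolding r_def using Suc.prems N d q by (subst powr_mult) (auto simp: powr_powr)
      finally have rd: "?d * r > 1" by (simp add: mult.commute)
      \<comment> \<open>The drop in potential pays for this split, so the initial potential bounds
        the number of splits. A tree with \<open>j\<close> splits has \<open>2 * j + 1\<close> nodes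
        and \<open>j + 1\<close> leaves; hence the factor 2 in the weight bound and the
        \<open>1 +\<close> in the cost bound.\<close>
      have gain: "?D * d1 * ((1 / 2) powr (1 / q) * r) + ?D * d2 * ((1 / 2) powr (1 / q) * r) + 1 \<le> ?D * ?d * r"
      proof -
        have "?D * ?d * r - ?D * ?d * ((1 / 2) powr (1 / q) * r)
          = (?D * (1 - (1 / 2) powr (1 / q))) * (?d * r)" by (simp add: algebra_simps)
        also have "\<dots> = ?d * r" using chain_const(2)[OF q] by simp
        finally have "?D * ?d * ((1 / 2) powr (1 / q) * r) + 1 \<le> ?D * ?d * r" using rd by linarith
        then show ?thesis unfolding d(3)[symmetric] by (simp only: distrib_left distrib_right)
      qed
      have half_pos: "h / 2 > 0" using Suc.prems by simp
      have "h / 2 * N * N powr q \<le> 2 ^ n" using Suc.prems by simp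
      moreover have "g (a + h / 2) - g a \<le> N" using d by (simp add: d1_def m_def)
      ultimately obtain t1 where t1: "fits g t1 a (h / 2)"
        "real (weight t1) \<le> 1 + real (rise t1) + 2 * (?D * d1 * ((1 / 2) powr (1 / q) * r))"
        "cost q t1 (h / 2) \<le> 4 powr q * (h / 2) + 2 powr q / N * (1 + ?D * d1 * ((1 / 2) powr (1 / q) * r))"
        using Suc.IH[of "h / 2" a] half_pos unfolding r' m_def[symmetric] d1_def[symmetric] by blast
      have "h / 2 * N * N powr q \<le> 2 ^ n" using Suc.prems by simp
      moreover have "g (m + h / 2) - g m \<le> N" using d unfolding mh by (simp add: d2_def)
      ultimately obtain t2 where t2: "fits g t2 m (h / 2)"
        "real (weight t2) \<le> 1 + real (rise t2) + 2 * (?D * d2 * ((1 / 2) powr (1 / q) * r))"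
        "cost q t2 (h / 2) \<le> 4 powr q * (h / 2) + 2 powr q / N * (1 + ?D * d2 * ((1 / 2) powr (1 / q) * r))"
        using Suc.IH[of "h / 2" m] half_pos unfolding r' mh d2_def[symmetric] by blast
      show ?thesis
      proof (intro exI conjI)
        show "fits g (Node t1 t2) a h" using t1(1) t2(1) by (simp add: m_def)
        show "real (weight (Node t1 t2)) \<le> 1 + real (rise (Node t1 t2)) +
          2 * (?D * ?d * (h * N) powr (1 / q))"
          using t1(2) t2(2) gain unfolding r_def[symmetric] weight.simps rise.simps of_nat_add of_nat_Suc
          by linarith
        have "cost q (Node t1 t2) h \<le> 4 powr q * h + 2 powr q / N *
          ((1 + ?D * d1 * ((1 / 2) powr (1 / q) * r)) + (1 + ?D * d2 * ((1 / 2) powr (1 / q) * r)))"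
          using t1(3) t2(3) unfolding cost.simps distrib_left[of "2 powr q / N"] by linarith
        also have "\<dots> \<le> 4 powr q * h + 2 powr q / N * (1 + ?D * ?d * r)"
          using gain N by (intro add_left_mono mult_left_mono) auto
        finally show "cost q (Node t1 t2) h \<le> 4 powr q * h + 2 powr q / N *
          (1 + ?D * ?d * (h * N) powr (1 / q))" unfolding r_def .
      qed
    qed
  }
qed

lemma uniform_adaptive_dyadic:
  assumes g: "mono g" and q: "q > 0" and N: "N > 0"
    and "h > 0" "g (a + h) - g a \<le> N" "h * N \<le> 2 ^ k"
  shows "\<exists>t. fits g t a h \<and>
    real (weight t) \<le> 2 * 2 ^ k - 1 + real (rise t) + 2 * (chain_const q * (g (a + h) - g a)) \<and>
    cost q t h \<le> 4 powr q * h + 2 powr q / N * (2 ^ k + chain_const q * (g (a + h) - g a))"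
  using assms(4-)
proof (induction k arbitrary: a h)
  case 0
  let ?d = "g (a + h) - g a"
  have d: "?d \<ge> 0" using g 0 by (simp add: monoD)
  have D: "chain_const q > 0" using chain_const q by simp
  obtain n where n: "h * N * N powr q \<le> 2 ^ n"
    using real_arch_pow[of 2 "h * N * N powr q"] by (auto intro: less_imp_le)
  from adaptive_dyadic[OF g q N 0(1,2) n] obtain t where t: "fits g t a h"
    "real (weight t) \<le> 1 + real (rise t) + 2 * (chain_const q * ?d * (h * N) powr (1 / q))"
    "cost q t h \<le> 4 powr q * h + 2 powr q / N * (1 + chain_const q * ?d * (h * N) powr (1 / q))"
    by blast
  have "(h * N) powr (1 / q) \<le> 1 powr (1 / q)" using 0 N q by (intro powr_mono2) auto
  then have le: "chain_const q * ?d * (h * N) powr (1 / q) \<le> chain_const q * ?d"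
    using d D by (intro mult_left_le) auto
  show ?case
  proof (intro exI conjI)
    show "fits g t a h" by fact
    show "real (weight t) \<le> 2 * 2 ^ 0 - 1 + real (rise t) + 2 * (chain_const q * ?d)"
      using t(2) le by simp
    have "2 powr q / N * (1 + chain_const q * ?d * (h * N) powr (1 / q)) \<le> 2 powr q / N * (1 + chain_const q * ?d)"
      using le N by (intro mult_left_mono) auto
    then show "cost q t h \<le> 4 powr q * h + 2 powr q / N * (2 ^ 0 + chain_const q * ?d)"
      using t(3) by simp
  qed
next
  case (Suc k)
  define m where "m = a + h / 2"
  have mh: "m + h / 2 = a + h" by (simp add: m_def)
  have d: "g a \<le> g m" "g m \<le> g (a + h)"
    using g Suc.prems by (auto simp: monoD m_def)
  have hs: "h / 2 > 0" "h / 2 * N \<le> 2 ^ k" using Suc.prems by auto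
  obtain t1 where t1: "fits g t1 a (h / 2)"
    "real (weight t1) \<le> 2 * 2 ^ k - 1 + real (rise t1) + 2 * (chain_const q * (g m - g a))"
    "cost q t1 (h / 2) \<le> 4 powr q * (h / 2) + 2 powr q / N * (2 ^ k + chain_const q * (g m - g a))"
    using Suc.IH[of "h / 2" a, folded m_def, OF hs(1) _ hs(2)] d Suc.prems(2) by fastforce
  obtain t2 where t2: "fits g t2 m (h / 2)"
    "real (weight t2) \<le> 2 * 2 ^ k - 1 + real (rise t2) + 2 * (chain_const q * (g (a + h) - g m))"
    "cost q t2 (h / 2) \<le> 4 powr q * (h / 2) + 2 powr q / N * (2 ^ k + chain_const q * (g (a + h) - g m))"
    using Suc.IH[of "h / 2" m, unfolded mh, OF hs(1) _ hs(2)] d Suc.prems(2) by fastforce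
  show ?case
  proof (intro exI conjI)
    show "fits g (Node t1 t2) a h" using t1 t2 by (simp add: m_def)
    show "real (weight (Node t1 t2)) \<le> 2 * 2 ^ Suc k - 1 + real (rise (Node t1 t2)) +
      2 * (chain_const q * (g (a + h) - g a))"
      using t1(2) t2(2) by (simp add: algebra_simps)
    have "cost q (Node t1 t2) h \<le> 4 powr q * h + 2 powr q / N * ((2 ^ k + chain_const q * (g m - g a))
        + (2 ^ k + chain_const q * (g (a + h) - g m)))"
      using t1(3) t2(3) by (simp add: distrib_left)
    also have "(2 ^ k + chain_const q * (g m - g a)) + (2 ^ k + chain_const q * (g (a + h) - g m))
      = 2 ^ Suc k + chain_const q * (g (a + h) - g a)" by (simp add: algebra_simps)
    finally show "cost q (Node t1 t2) h \<le> 4 powr q * h + 2 powr q / N *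
      (2 ^ Suc k + chain_const q * (g (a + h) - g a))" .
  qed
qed

text \<open>The preceding cost bound for \<open>h = 1\<close>, \<open>N = 2 ^ k\<close> and an
  increase of at most \<open>N\<close>, where the powers \<open>2 ^ k\<close> cancel.\<close>

definition cost_const :: "real \<Rightarrow> real" where
  "cost_const q = 4 powr q + 2 powr q * (1 + chain_const q)"

text \<open>The increments sum to \<open>\<lfloor>g 1\<rfloor>\<close>, so recording them adds at
  most \<open>2 ^ k\<close> to the weight of the nodes.\<close>

lemma dyadic_exists:
  assumes g: "mono g" "g 0 = 0" "g 1 \<le> 2 ^ k" and q: "q > 0"
  shows "\<exists>t. fits g t 0 1 \<and> real (weight t) \<le> (3 + 2 * chain_const q) * 2 ^ k \<and> cost q t 1 \<le> cost_const q"
proof -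
  have D: "chain_const q > 0" using chain_const q by simp
  obtain t where t: "fits g t 0 1"
    "real (weight t) \<le> 2 * 2 ^ k - 1 + real (rise t) + 2 * (chain_const q * g 1)"
    "cost q t 1 \<le> 4 powr q + 2 powr q / 2 ^ k * (2 ^ k + chain_const q * g 1)"
    using uniform_adaptive_dyadic[OF g(1) q, of "2 ^ k" 1 0 k] g by auto
  have "real_of_int (int (rise t)) = of_int \<lfloor>g 1\<rfloor>" using fits_floor[OF t(1)] g by simp
  also have "\<dots> \<le> g 1" by simp
  also note g(3)
  finally have r: "real (rise t) \<le> 2 ^ k" by simp
  have c: "chain_const q * g 1 \<le> chain_const q * 2 ^ k"
    using g(3) D by (intro mult_left_mono) auto
  have "2 powr q / 2 ^ k * (2 ^ k + chain_const q * g 1) \<le> 2 powr q / 2 ^ k * (2 ^ k + chain_const q * 2 ^ k)"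
    using c by (intro mult_left_mono) auto
  also have "\<dots> = 2 powr q * (1 + chain_const q)" by (simp add: field_simps)
  finally have "cost q t 1 \<le> cost_const q" using t(3) by (simp add: cost_const_def)
  moreover have "real (weight t) \<le> (3 + 2 * chain_const q) * 2 ^ k"
  proof -
    have "(3 + 2 * chain_const q) * 2 ^ k = 3 * 2 ^ k + 2 * (chain_const q * 2 ^ k)"
      by (simp add: distrib_right)
    then show ?thesis using t(2) r c by linarith
  qed
  ultimately show ?thesis using t(1) by blast
qed

section \<open>Measurability, bounds and integrals of the step functions\<close>

lemma measurable_lower_gap [measurable]:
  "lower t a h \<in> borel_measurable borel" "gap t a h \<in> borel_measurable borel"
proof (induction t arbitrary: a h)
  case (Node s t)
  note [measurable] = Node.IH
  { case 1 show ?case by (simp add: fun_eq_iff[THEN iffD2, OF allI, OF lower.simps(2)]) next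
    case 2 show ?case by (simp add: fun_eq_iff[THEN iffD2, OF allI, OF gap.simps(2)]) }
qed (simp_all add: fun_eq_iff[THEN iffD2, OF allI, OF lower.simps(1)] fun_eq_iff[THEN iffD2, OF allI, OF gap.simps(1)])

lemma lower_nonneg: "lower t a h y \<ge> 0"
  by (induction t arbitrary: a h) auto

lemma lower_le_weight: "lower t a h y \<le> weight t"
proof -
  have r: "rise t \<le> weight t" for t by (induction t) auto
  show ?thesis
  proof (induction t arbitrary: a h)
    case (Node s t)
    have "real (rise s) \<le> real (weight s)" using r[of s] by simp
    then show ?case using Node.IH(1)[of a "h / 2"] Node.IH(2)[of "a + h / 2" "h / 2"] by simp
  qed simp
qed

lemma gap_ge_1: "gap t a h y \<ge> 1"
  by (induction t arbitrary: a h) auto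

lemma gap_le_weight: "gap t a h y \<le> weight t"
proof (induction t arbitrary: a h)
  case (Node s t)
  show ?case
  proof (cases "y < a + h / 2")
    case True
    then show ?thesis using Node.IH(1)[of a "h / 2"] by simp
  next
    case False
    then show ?thesis using Node.IH(2)[of "a + h / 2" "h / 2"] by simp
  qed
qed simp

lemma cost_nonneg: "h \<ge> 0 \<Longrightarrow> cost q t h \<ge> 0"
  by (induction t arbitrary: h) auto

text \<open>The gap is constant on each leaf cell, so the integral is a sum over cells; replacing
  each cell probability by \<open>k\<close> times the cell length turns it into
  \<open>cost\<close>.\<close>

lemma (in prob_space) nn_integral_gap_le:
  assumes U [measurable]: "U \<in> borel_measurable M"
    and k: "k \<ge> 0" "\<And>a b. a \<le> b \<Longrightarrow> prob {x \<in> space M. a \<le> U x \<and> U x < b} \<le> k * (b - a)"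
    and h: "h \<ge> 0"
  shows "(\<integral>\<^sup>+x. ennreal (gap t a h (U x) powr q) * indicator {x \<in> space M. a \<le> U x \<and> U x < a + h} x \<partial>M)
    \<le> ennreal (k * cost q t h)"
  using h
proof (induction t arbitrary: a h)
  case (Leaf n)
  have "(\<integral>\<^sup>+x. ennreal (gap (Leaf n) a h (U x) powr q) * indicator {x \<in> space M. a \<le> U x \<and> U x < a + h} x \<partial>M)
    = ennreal (real (Suc n) powr q) * emeasure M {x \<in> space M. a \<le> U x \<and> U x < a + h}"
    by (simp add: nn_integral_cmult_indicator)
  also have "\<dots> = ennreal (real (Suc n) powr q * prob {x \<in> space M. a \<le> U x \<and> U x < a + h})"
    by (simp add: emeasure_eq_measure ennreal_mult)
  also have "\<dots> \<le> ennreal (real (Suc n) powr q * (k * h))"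
    using k(2)[of a "a + h"] Leaf by (intro ennreal_leI mult_left_mono) auto
  also have "\<dots> = ennreal (k * cost q (Leaf n) h)" by (simp add: mult_ac)
  finally show ?case .
next
  case (Node s t)
  let ?m = "a + h / 2"
  let ?f = "\<lambda>t a h x. ennreal (gap t a h (U x) powr q) * indicator {x \<in> space M. a \<le> U x \<and> U x < a + h} x"
  have mh: "?m + h / 2 = a + h" by simp
  have "(\<integral>\<^sup>+x. ?f (Node s t) a h x \<partial>M) \<le> (\<integral>\<^sup>+x. ?f s a (h / 2) x + ?f t ?m (h / 2) x \<partial>M)"
    using Node.prems unfolding mh by (intro nn_integral_mono) (auto simp: indicator_def)
  also have "\<dots> = (\<integral>\<^sup>+x. ?f s a (h / 2) x \<partial>M) + (\<integral>\<^sup>+x. ?f t ?m (h / 2) x \<partial>M)"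
    by (rule nn_integral_add) measurable
  also have "\<dots> \<le> ennreal (k * cost q s (h / 2)) + ennreal (k * cost q t (h / 2))"
    using Node.prems by (intro add_mono Node.IH) auto
  also have "\<dots> = ennreal (k * cost q (Node s t) h)"
    using Node.prems k cost_nonneg[of "h / 2"] by (simp add: ennreal_plus[symmetric] distrib_left del: ennreal_plus)
  finally show ?case .
qed

subsection \<open>Brackets for monotone functions of a random variable\<close>

text \<open>Without atoms the cdf is continuous, and evaluated at the variable itself it is uniform
  on the unit interval; the right-hand side is the uniform distribution function.\<close>

lemma (in real_distribution) measure_cdf_less:
  assumes "\<And>x. measure M {x} = 0"
  shows "measure M {y. cdf M y < b} = min 1 (max 0 b)"
proof -
  consider "b \<le> 0" | "b > 1" | "0 < b" "b \<le> 1" by linarith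
  then show ?thesis
  proof cases
    case 1
    then have "{y. cdf M y < b} = {}" using cdf_nonneg by (auto simp: not_less intro: order_trans)
    then show ?thesis using 1 by simp
  next
    case 2
    then have "{y. cdf M y < b} = space M" using cdf_bounded_prob by (auto intro: le_less_trans)
    then show ?thesis using 2 prob_space by simp
  next
    case 3
    show ?thesis
    proof (cases "{y. b \<le> cdf M y} = {}")
      case True
      then have less: "cdf M y < b" for y by (auto simp: not_le)
      \<comment> \<open>The cdf tends to 1 while staying below \<open>b\<close>, so only
        \<open>b = 1\<close> remains.\<close>
      then have "1 \<le> b"
        by (intro tendsto_upperbound[OF cdf_lim_at_top_prob]) (auto intro!: always_eventually less_imp_le)
      moreover have "{y. cdf M y < b} = space M" using less by auto
      ultimately show ?thesis using 3 prob_space by simp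
    next
      case False
      let ?S = "{y. b \<le> cdf M y}"
      have cont: "isCont (cdf M) x" for x using isCont_cdf assms by simp
      have "closed ?S" using cont by (intro closed_Collect_le continuous_at_imp_continuous_on) auto
      moreover have bdd: "bdd_below ?S"
      proof -
        have "eventually (\<lambda>y. cdf M y < b) at_bot"
          using order_tendstoD(2)[OF cdf_lim_at_bot] 3 by simp
        then obtain z where z: "\<And>y. y \<le> z \<Longrightarrow> cdf M y < b" by (auto simp: eventually_at_bot_linorder)
        then show ?thesis by (intro bdd_belowI[of _ z]) (metis linear mem_Collect_eq not_le)
      qed
      ultimately have c: "Inf ?S \<in> ?S" using closed_contains_Inf[of ?S] False by blast
      \<comment> \<open>The smallest point where the cdf reaches \<open>b\<close>: it exists because
        the cdf is continuous and tends to 0 at minus infinity. The event is the half-line below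
        \<open>c\<close>, and left continuity makes the cdf at \<open>c\<close> equal to
        \<open>b\<close>.\<close>
      define c where "c = Inf ?S"
      have below: "cdf M y < b" if "y < c" for y
        using cInf_lower[of y ?S] bdd that by (force simp: c_def)
      have set: "{y. cdf M y < b} = {..<c}"
      proof (intro equalityI subsetI)
        fix y assume "y \<in> {y. cdf M y < b}"
        then have "\<not> c \<le> y" using cdf_nondecreasing[of c y] c unfolding c_def[symmetric] by auto
        then show "y \<in> {..<c}" by simp
      qed (use below in auto)
      have "cdf M c \<le> b"
      proof (rule tendsto_upperbound)
        show "(cdf M \<longlongrightarrow> cdf M c) (at_left c)"
          using cont[of c] by (simp add: isCont_def filterlim_at_split)
        show "\<forall>\<^sub>F y in at_left c. cdf M y \<le> b"
          using below by (auto simp: eventually_at_filter intro!: always_eventually less_imp_le)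
      qed simp
      moreover have "cdf M c = measure M {..<c}"
      proof -
        have "{..c} = {..<c} \<union> {c}" by auto
        then have "measure M {..c} = measure M {..<c} + measure M {c}"
          by (simp add: finite_measure_Union del: Un_insert_right)
        then show ?thesis using assms by (simp add: cdf_def)
      qed
      ultimately show ?thesis using 3 c unfolding set by (simp add: c_def)
    qed
  qed
qed

text \<open>Follows from uniformity of the transformed variable; clipping to the unit interval is
  1-Lipschitz, so the ends may lie outside it.\<close>

lemma (in prob_space) prob_cdf_between_le:
  assumes X [measurable]: "X \<in> borel_measurable M"
    and "\<And>z. prob {x \<in> space M. X x = z} = 0" and "a \<le> b"
  shows "prob {x \<in> space M. a \<le> cdf (distr M borel X) (X x) \<and> cdf (distr M borel X) (X x) < b} \<le> b - a"
proof -
  let ?D = "distr M borel X"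
  interpret D: real_distribution ?D by (rule real_distribution_distr) fact
  have [measurable]: "cdf ?D \<in> borel_measurable borel"
    using D.cdf_nondecreasing by (intro borel_measurable_mono monoI)
  have "measure ?D {z} = 0" for z
    using assms(2)[of z] by (subst measure_distr) (auto simp: vimage_def Int_def conj_commute)
  note less = D.measure_cdf_less[OF this]
  have "{x \<in> space M. a \<le> cdf ?D (X x) \<and> cdf ?D (X x) < b} = X -` {y. a \<le> cdf ?D y \<and> cdf ?D y < b} \<inter> space M"
    by auto
  then have "prob {x \<in> space M. a \<le> cdf ?D (X x) \<and> cdf ?D (X x) < b} = measure ?D {y. a \<le> cdf ?D y \<and> cdf ?D y < b}"
    by (simp add: measure_distr)
  also have "{y. a \<le> cdf ?D y \<and> cdf ?D y < b} = {y. cdf ?D y < b} - {y. cdf ?D y < a}"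
    by (auto simp: not_less)
  also have "measure ?D \<dots> = measure ?D {y. cdf ?D y < b} - measure ?D {y. cdf ?D y < a}"
    using \<open>a \<le> b\<close> by (intro D.finite_measure_Diff) auto
  also have "\<dots> \<le> b - a" using \<open>a \<le> b\<close> by (simp add: less)
  finally show ?thesis .
qed

text \<open>The increment of \<open>f\<close> is the length of the set of levels \<open>s\<close>
  passed between the two arguments. After exchanging integrals, a fixed level is passed only if
  \<open>X\<close> lies within \<open>c\<close> of the point where \<open>f\<close> crosses it,
  which has probability at most \<open>2 * c * L\<close>; only levels in \<open>{0..W}\<close>
  contribute.\<close>

lemma (in prob_space) nn_integral_mono_shift_le:
  fixes f :: "real \<Rightarrow> real"
  assumes X [measurable]: "X \<in> borel_measurable M"
    and L: "L \<ge> 0" "\<And>a b. a \<le> b \<Longrightarrow> prob {x \<in> space M. a \<le> X x \<and> X x \<le> b} \<le> L * (b - a)"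
    and f: "mono f" "\<And>y. f y \<in> {0..W}" and c: "c \<ge> 0"
  shows "(\<integral>\<^sup>+x. ennreal (f (X x + c) - f (X x - c)) \<partial>M) \<le> ennreal (2 * c * L * W)"
proof -
  interpret pair_sigma_finite M lborel ..
  have W: "W \<ge> 0" using f(2)[of 0] by simp
  have [measurable]: "f \<in> borel_measurable borel" using f(1) by (rule borel_measurable_mono)
  have "(\<integral>\<^sup>+x. ennreal (f (X x + c) - f (X x - c)) \<partial>M)
    = (\<integral>\<^sup>+x. (\<integral>\<^sup>+s. indicator {f (X x - c)..<f (X x + c)} s \<partial>lborel) \<partial>M)"
    using f(1) c by (intro nn_integral_cong) (simp add: monoD)
  also have "\<dots> = (\<integral>\<^sup>+s. (\<integral>\<^sup>+x. indicator {f (X x - c)..<f (X x + c)} s \<partial>M) \<partial>lborel)"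
    unfolding indicator_def by (rule Fubini'[symmetric]) simp
  also have "\<dots> \<le> (\<integral>\<^sup>+s. ennreal (2 * c * L) * indicator {0..W} s \<partial>lborel)"
  proof (rule nn_integral_mono)
    fix s :: real
    let ?S = "{x \<in> space M. f (X x - c) \<le> s \<and> s < f (X x + c)}"
    have S: "(\<integral>\<^sup>+x. indicator {f (X x - c)..<f (X x + c)} s \<partial>M) = prob ?S"
    proof -
      have "(\<integral>\<^sup>+x. indicator {f (X x - c)..<f (X x + c)} s \<partial>M) = (\<integral>\<^sup>+x. indicator ?S x \<partial>M)"
        by (intro nn_integral_cong) (auto simp: indicator_def)
      then show ?thesis by (simp add: emeasure_eq_measure)
    qed
    show "(\<integral>\<^sup>+x. indicator {f (X x - c)..<f (X x + c)} s \<partial>M) \<le> ennreal (2 * c * L) * indicator {0..W} s"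
    proof (cases "?S = {}")
      case True
      then show ?thesis unfolding S by (simp only: measure_empty) simp
    next
      case False
      then obtain x0 where x0: "f (X x0 - c) \<le> s" "s < f (X x0 + c)" by auto
      then have s: "s \<in> {0..W}" using f(2)[of "X x0 - c"] f(2)[of "X x0 + c"] by auto
      \<comment> \<open>The crossing point of the level \<open>s\<close>.\<close>
      define z where "z = Sup {y. f y \<le> s}"
      have upper: "y \<le> y'" if "f y \<le> s" "s < f y'" for y y'
        using monoD[OF f(1), of y' y] that by linarith
      have bdd: "bdd_above {y. f y \<le> s}" using upper x0(2) by (intro bdd_aboveI) auto
      have "?S \<subseteq> {x \<in> space M. z - c \<le> X x \<and> X x \<le> z + c}"
      proof clarify
        fix x assume x: "x \<in> space M" "f (X x - c) \<le> s" "s < f (X x + c)"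
        have "X x - c \<le> z" unfolding z_def using x bdd by (intro cSup_upper) auto
        moreover have "z \<le> X x + c" unfolding z_def using x upper by (intro cSup_least) auto
        ultimately show "z - c \<le> X x \<and> X x \<le> z + c" by simp
      qed
      then have "prob ?S \<le> prob {x \<in> space M. z - c \<le> X x \<and> X x \<le> z + c}"
        by (intro finite_measure_mono) auto
      also have "\<dots> \<le> L * ((z + c) - (z - c))" using c by (intro L) simp
      finally show ?thesis unfolding S using s by (simp add: ennreal_leI mult_ac)
    qed
  qed
  also have "\<dots> = ennreal (2 * c * L * W)"
    using W L c by (simp add: nn_integral_cmult_indicator ennreal_mult)
  finally show ?thesis .
qed

text \<open>\<open>f\<close> need not be a function of \<open>F\<close>, since \<open>F\<close> may
  be constant where \<open>f\<close> grows. The tree encodes instead a multiple of the infimum of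
  \<open>f\<close> over the points where \<open>F / 2\<close> is at least \<open>s\<close>. After
  rescaling, this lies below \<open>f y\<close> for \<open>s\<close> up to \<open>F y / 2\<close>
  and above it for larger \<open>s\<close>, because a larger value of the monotone \<open>F\<close>
  forces a larger argument.\<close>

lemma dyadic_bracket:
  fixes f F :: "real \<Rightarrow> real"
  assumes f: "mono f" "\<And>y. f y \<in> {0..W}" and F: "mono F" "\<And>y. F y \<in> {0..1}"
    and W: "W > 0" and q: "q > 0"
  shows "\<exists>t. real (weight t) \<le> (3 + 2 * chain_const q) * 2 ^ k \<and> cost q t 1 \<le> cost_const q \<and>
    (\<forall>y. W / 2 ^ k * lower t 0 1 (F y / 2) \<le> f y \<and>
         f y \<le> W / 2 ^ k * (lower t 0 1 (F y / 2) + gap t 0 1 (F y / 2)))"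
proof -
  \<comment> \<open>The factor 1/2 keeps \<open>F\<close> inside the half-open interval that a tree partitions, and
    \<open>insert W\<close> keeps the infimum meaningful.\<close>
  define A where "A s = insert W {f y | y. s \<le> F y / 2}" for s
  \<comment> \<open>The value 0 for \<open>s \<le> 0\<close> anchors the floors at 0, so the
    brackets become absolute; the scaling makes one unit of \<open>G\<close> stand for
    \<open>W / 2 ^ k\<close>.\<close>
  define G where "G s = (if s \<le> 0 then 0 else 2 ^ k / W * Inf (A s))" for s
  have A0: "0 \<le> x" if "x \<in> A s" for x s using that f(2) W by (auto simp: A_def)
  have bdd: "bdd_below (A s)" for s using A0 by (intro bdd_belowI)
  have AW: "Inf (A s) \<le> W" for s using bdd by (intro cInf_lower) (auto simp: A_def)
  have Apos: "Inf (A s) \<ge> 0" for s using A0 by (intro cInf_greatest) (auto simp: A_def)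
  have "mono G"
  proof (rule monoI)
    fix x y :: real assume "x \<le> y"
    have "Inf (A x) \<le> Inf (A y)" if "x > 0"
      using bdd \<open>x \<le> y\<close> by (intro cInf_superset_mono) (auto simp: A_def)
    then show "G x \<le> G y" using \<open>x \<le> y\<close> W Apos
      by (auto simp: G_def intro!: divide_right_mono mult_left_mono mult_nonneg_nonneg)
  qed
  moreover have "G 0 = 0" by (simp add: G_def)
  moreover have "G 1 \<le> 2 ^ k"
  proof -
    have "2 ^ k / W * Inf (A 1) \<le> 2 ^ k / W * W" using AW W by (intro mult_left_mono) auto
    then show ?thesis using W by (simp add: G_def)
  qed
  ultimately obtain t where t: "fits G t 0 1" "real (weight t) \<le> (3 + 2 * chain_const q) * 2 ^ k"
    "cost q t 1 \<le> cost_const q"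
    using dyadic_exists[of G k q] q by auto
  have "W / 2 ^ k * lower t 0 1 (F y / 2) \<le> f y \<and>
         f y \<le> W / 2 ^ k * (lower t 0 1 (F y / 2) + gap t 0 1 (F y / 2))" for y
  proof -
    have "0 \<le> F y / 2" "F y / 2 < 0 + 1" using F(2)[of y] by auto
    then obtain a b where ab: "a \<le> F y / 2" "F y / 2 < b" "lower t 0 1 (F y / 2) \<le> G a"
      "G b \<le> lower t 0 1 (F y / 2) + gap t 0 1 (F y / 2)"
      using fits_sound[OF t(1), of "F y / 2"] \<open>G 0 = 0\<close> by auto
    have "W / 2 ^ k * G a \<le> f y"
    proof (cases "a \<le> 0")
      case True
      then show ?thesis using f(2)[of y] by (simp add: G_def)
    next
      case False
      have "Inf (A a) \<le> f y" using bdd ab by (intro cInf_lower) (auto simp: A_def)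
      then show ?thesis using False W by (simp add: G_def)
    qed
    moreover have "W / 2 ^ k * lower t 0 1 (F y / 2) \<le> W / 2 ^ k * G a"
      using ab W by (intro mult_left_mono) auto
    moreover have "f y \<le> W / 2 ^ k * G b"
    proof -
      have "b > 0" using ab F(2)[of y] by auto
      moreover have "f y \<le> Inf (A b)"
      proof (rule cInf_greatest)
        fix v assume "v \<in> A b"
        then consider "v = W" | y' where "v = f y'" "b \<le> F y' / 2" by (auto simp: A_def)
        then show "f y \<le> v"
        proof cases
          case 1
          then show ?thesis using f(2)[of y] by simp
        next
          case 2
          then have "F y < F y'" using ab by linarith
          then have "y \<le> y'" using monoD[OF F(1), of y' y] by linarith
          then show ?thesis using 2 f(1) by (simp add: monoD)
        qed
      qed (auto simp: A_def)
      ultimately show ?thesis using W by (simp add: G_def)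
    qed
    moreover have "W / 2 ^ k * G b \<le> W / 2 ^ k * (lower t 0 1 (F y / 2) + gap t 0 1 (F y / 2))"
      using ab W by (intro mult_left_mono) auto
    ultimately show ?thesis by linarith
  qed
  with t show ?thesis by blast
qed

subsection \<open>Functions of bounded variation\<close>

text \<open>Jordan decomposition: \<open>v\<close> is the variation up to a point, and both
  \<open>v\<close> and \<open>v - \<tau>\<close> increase. Adding \<open>M\<close> makes both parts
  nonnegative; \<open>max 0 V\<close> appears because \<open>ennreal\<close> sends negative numbers
  to 0.\<close>

lemma total_variation_imp_diff_mono:
  assumes "total_variation \<tau> \<le> ennreal V" and "\<And>y. \<tau> y \<in> {-M..M}"
  shows "\<exists>f g. mono f \<and> mono g \<and> (\<forall>y. f y \<in> {0..max 0 V + 2 * M} \<and> g y \<in> {0..max 0 V + 2 * M} \<and>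
    \<tau> y = f y - g y)"
proof -
  define S where "S n t = (\<Sum>i<n. \<bar>\<tau> (t (Suc i)) - \<tau> (t i)\<bar>)" for n and t :: "nat \<Rightarrow> real"
  \<comment> \<open>Only \<open>t 0\<close> to \<open>t n\<close> enter the sum, so fixing
    \<open>t n = y\<close> restricts the variation to the half-line up to \<open>y\<close>.\<close>
  define A where "A y = {S n t | n t. mono t \<and> t n = y}" for y
  define v where "v y = Sup (A y)" for y
  have S: "S n t \<le> max 0 V" if "mono t" for n t
  proof -
    have "ennreal (S n t) \<le> total_variation \<tau>"
      unfolding total_variation_def S_def using that by (intro SUP_upper2[of "(n, t)"]) auto
    then have "ennreal (S n t) \<le> ennreal (max 0 V)" using assms(1) by (simp add: ennreal_max_0)
    then show ?thesis by (subst (asm) ennreal_le_iff) auto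
  qed
  then have bdd: "bdd_above (A y)" for y by (intro bdd_aboveI[of _ "max 0 V"]) (auto simp: A_def)
  have A0: "0 \<in> A y" for y
    unfolding A_def by (rule CollectI, intro exI[of _ 0] exI[of _ "\<lambda>_. y"]) (simp add: S_def mono_def)
  have v: "0 \<le> v y" "v y \<le> max 0 V" for y
  proof -
    show "0 \<le> v y" unfolding v_def using A0 bdd by (intro cSup_upper)
    show "v y \<le> max 0 V" unfolding v_def using A0 S
      by (intro cSup_least) (auto simp: A_def)
  qed
  have incr: "v a + \<bar>\<tau> b - \<tau> a\<bar> \<le> v b" if "a \<le> b" for a b
  proof -
    have "x \<le> v b - \<bar>\<tau> b - \<tau> a\<bar>" if "x \<in> A a" for x
    proof -
      obtain n t where t: "mono t" "t n = a" "x = S n t" using \<open>x \<in> A a\<close> by (auto simp: A_def)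
      \<comment> \<open>Appending \<open>b\<close> to a sequence that ends at \<open>a\<close> adds
        the jump from \<open>a\<close> to \<open>b\<close>.\<close>
      define t' where "t' i = (if i \<le> n then t i else b)" for i
      have "mono t'"
      proof (rule monoI)
        fix i j :: nat assume "i \<le> j"
        have "t i \<le> b" if "i \<le> n" using monoD[OF t(1) that] t(2) \<open>a \<le> b\<close> by simp
        then show "t' i \<le> t' j" using monoD[OF t(1) \<open>i \<le> j\<close>] \<open>i \<le> j\<close> by (auto simp: t'_def)
      qed
      then have "S (Suc n) t' \<in> A b" unfolding A_def by (force simp: t'_def)
      then have "S (Suc n) t' \<le> v b" unfolding v_def using bdd by (rule cSup_upper)
      moreover have "S (Suc n) t' = S n t + \<bar>\<tau> b - \<tau> a\<bar>"
        by (simp add: S_def t'_def t(2))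
      ultimately show ?thesis using t(3) by simp
    qed
    then have "v a \<le> v b - \<bar>\<tau> b - \<tau> a\<bar>"
      unfolding v_def[of a] using A0 by (intro cSup_least) auto
    then show ?thesis by simp
  qed
  show ?thesis
  proof (intro exI conjI allI)
    show "mono (\<lambda>y. v y + M)" using incr by (intro monoI) (smt (verit))
    show "mono (\<lambda>y. v y - \<tau> y + M)" using incr by (intro monoI) (smt (verit))
    show "v y + M \<in> {0..max 0 V + 2 * M}" "v y - \<tau> y + M \<in> {0..max 0 V + 2 * M}" for y
      using v[of y] assms(2)[of y] by auto
  qed simp
qed

subsection \<open>Brackets for compositions\<close>

lemma (in prob_space) bounded_in_Lq_space:
  assumes [measurable]: "f \<in> borel_measurable M" and "\<And>x. x \<in> space M \<Longrightarrow> \<bar>f x\<bar> \<le> B" and "q > 0"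
  shows "f \<in> Lq_space q M"
proof -
  have "integrable M (\<lambda>x. \<bar>f x\<bar> powr q)"
    by (rule integrable_const_bound[where B = "B powr q"])
      (use assms in \<open>auto intro!: AE_I2 powr_mono2\<close>)
  then show ?thesis by (simp add: Lq_space_def)
qed

lemma Lq_norm_le:
  assumes "(\<integral>\<^sup>+x. ennreal (\<bar>f x\<bar> powr q) \<partial>M) \<le> ennreal K" and "K \<ge> 0" and "q > 0"
  shows "Lq_norm q M f \<le> K powr (1 / q)"
  unfolding Lq_norm_def using assms
  by (intro powr_mono2 integral_real_bounded) auto

lemma (in prob_space) prob_between_le_if_density_bounded:
  assumes "has_density_bounded_by M X L" and "L \<ge> 0" and "a \<le> b"
  shows "prob {x \<in> space M. a \<le> X x \<and> X x \<le> b} \<le> L * (b - a)"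
proof -
  obtain p where p: "distributed M lborel X p" "\<And>y. p y \<le> ennreal L"
    using assms(1) by (auto simp: has_density_bounded_by_def)
  have "emeasure M {x \<in> space M. a \<le> X x \<and> X x \<le> b} = emeasure M (X -` {a..b} \<inter> space M)"
    by (rule arg_cong[where f = "emeasure M"]) auto
  also have "\<dots> = (\<integral>\<^sup>+y. p y * indicator {a..b} y \<partial>lborel)"
    by (rule distributed_emeasure[OF p(1)]) simp
  also have "\<dots> \<le> (\<integral>\<^sup>+y. ennreal L * indicator {a..b} y \<partial>lborel)"
    using p(2) by (intro nn_integral_mono mult_right_mono) auto
  also have "\<dots> = ennreal (L * (b - a))"
    using assms by (simp add: nn_integral_cmult_indicator ennreal_mult)
  finally show ?thesis using assms by (simp add: emeasure_eq_measure)
qed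

text \<open>The bracket has to enclose \<open>f\<close> at all points within
  \<open>2 * e powr q\<close> of \<open>X\<close>, so one tree encodes \<open>f\<close> shifted down
  to \<open>X - c\<close> and another \<open>f\<close> shifted up to \<open>X + c\<close>. The width
  is at most the two gaps, controlled by the costs of the trees, plus the increment of
  \<open>f\<close> between the shifted points, controlled in mean.\<close>

lemma (in prob_space) mono_bracket:
  fixes f :: "real \<Rightarrow> real" and k :: nat
  assumes X [measurable]: "X \<in> borel_measurable M"
    and L: "L \<ge> 0" "\<And>a b. a \<le> b \<Longrightarrow> prob {x \<in> space M. a \<le> X x \<and> X x \<le> b} \<le> L * (b - a)"
    and f: "mono f" "\<And>y. f y \<in> {0..W}" and W: "W > 0" and q: "q \<ge> 1"
    and e: "1 / 2 ^ k \<le> e"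
  defines "s \<equiv> W / 2 ^ k" and "U \<equiv> \<lambda>x. cdf (distr M borel X) (X x) / 2"
  shows "\<exists>t1 t2. real (weight t1) \<le> (3 + 2 * chain_const q) * 2 ^ k \<and>
    real (weight t2) \<le> (3 + 2 * chain_const q) * 2 ^ k \<and>
    (\<forall>x. s * lower t1 0 1 (U x) \<le> f (X x - 2 * e powr q) \<and>
      f (X x + 2 * e powr q) \<le> s * (lower t2 0 1 (U x) + gap t2 0 1 (U x))) \<and>
    (\<integral>\<^sup>+x. ennreal ((s * (lower t2 0 1 (U x) + gap t2 0 1 (U x)) - s * lower t1 0 1 (U x)) powr q) \<partial>M)
      \<le> ennreal ((4 * W) powr q * 4 * (cost_const q + L) * e powr q)"
proof -
  define c where "c = 2 * e powr q"
  have "0 < 1 / (2::real) ^ k" by simp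
  then have e0: "e > 0" using e by linarith
  have c0: "c \<ge> 0" by (simp add: c_def)
  have q0: "q > 0" using q by simp
  have s0: "s > 0" using W by (simp add: s_def)
  let ?F = "cdf (distr M borel X)"
  interpret D: real_distribution "distr M borel X" by (rule real_distribution_distr) fact
  have F: "mono ?F" "?F y \<in> {0..1}" for y
    using D.cdf_nondecreasing D.cdf_nonneg D.cdf_bounded_prob by (auto intro: monoI)
  have [measurable]: "?F \<in> borel_measurable borel" using F(1) by (rule borel_measurable_mono)
  have [measurable]: "U \<in> borel_measurable M" unfolding U_def by measurable
  have [measurable]: "f \<in> borel_measurable borel" using f(1) by (rule borel_measurable_mono)
  have X0: "prob {x \<in> space M. X x = z} = 0" for z
  proof -
    have "prob {x \<in> space M. X x = z} = prob {x \<in> space M. z \<le> X x \<and> X x \<le> z}"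
      by (rule arg_cong[where f = prob]) auto
    also have "\<dots> \<le> 0" using L(2)[of z z] by simp
    finally show ?thesis by (simp add: measure_le_0_iff)
  qed
  \<comment> \<open>\<open>U\<close> is uniform on an interval of length 1/2, hence the factor
    2.\<close>
  have U: "prob {x \<in> space M. a \<le> U x \<and> U x < b} \<le> 2 * (b - a)" if "a \<le> b" for a b
  proof -
    have "{x \<in> space M. a \<le> U x \<and> U x < b} = {x \<in> space M. 2 * a \<le> ?F (X x) \<and> ?F (X x) < 2 * b}"
      by (auto simp: U_def)
    then show ?thesis using prob_cdf_between_le[OF X X0, of "2 * a" "2 * b"] that by simp
  qed
  have U01: "0 \<le> U x" "U x < 1" for x using F(2)[of "X x"] by (auto simp: U_def)
  have gap_int: "(\<integral>\<^sup>+x. ennreal (gap t 0 1 (U x) powr q) \<partial>M) \<le> ennreal (2 * cost_const q)"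
    if "cost q t 1 \<le> cost_const q" for t
  proof -
    have "(\<integral>\<^sup>+x. ennreal (gap t 0 1 (U x) powr q) \<partial>M)
      = (\<integral>\<^sup>+x. ennreal (gap t 0 1 (U x) powr q) * indicator {x \<in> space M. 0 \<le> U x \<and> U x < 0 + 1} x \<partial>M)"
      using U01 by (intro nn_integral_cong) (auto simp: indicator_def)
    also have "\<dots> \<le> ennreal (2 * cost q t 1)"
      by (rule nn_integral_gap_le) (use U in auto)
    also have "\<dots> \<le> ennreal (2 * cost_const q)" using that by (intro ennreal_leI) simp
    finally show ?thesis .
  qed
  have shift: "\<exists>t. real (weight t) \<le> (3 + 2 * chain_const q) * 2 ^ k \<and> cost q t 1 \<le> cost_const q \<and>
    (\<forall>x. s * lower t 0 1 (U x) \<le> f (X x + r) \<and>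
         f (X x + r) \<le> s * (lower t 0 1 (U x) + gap t 0 1 (U x)))" for r
  proof -
    have "mono (\<lambda>y. f (y + r))" using f(1) by (auto simp: mono_def)
    from dyadic_bracket[OF this f(2) F W q0, of k] show ?thesis
      unfolding s_def U_def by fast
  qed
  obtain t1 where t1: "real (weight t1) \<le> (3 + 2 * chain_const q) * 2 ^ k" "cost q t1 1 \<le> cost_const q"
    "\<And>x. s * lower t1 0 1 (U x) \<le> f (X x - c)"
    "\<And>x. f (X x - c) \<le> s * (lower t1 0 1 (U x) + gap t1 0 1 (U x))"
    using shift[of "- c"] by auto
  obtain t2 where t2: "real (weight t2) \<le> (3 + 2 * chain_const q) * 2 ^ k" "cost q t2 1 \<le> cost_const q"
    "\<And>x. s * lower t2 0 1 (U x) \<le> f (X x + c)"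
    "\<And>x. f (X x + c) \<le> s * (lower t2 0 1 (U x) + gap t2 0 1 (U x))"
    using shift[of c] by auto
  let ?w = "\<lambda>x. s * (lower t2 0 1 (U x) + gap t2 0 1 (U x)) - s * lower t1 0 1 (U x)"
  let ?g = "\<lambda>t x. gap t 0 1 (U x)"
  let ?d = "\<lambda>x. f (X x + c) - f (X x - c)"
  \<comment> \<open>Since the increment lies between 0 and \<open>W\<close> and
    \<open>q \<ge> 1\<close>, its \<open>q\<close>-th power is at most \<open>W powr (q - 1)\<close>
    times itself, so a bound on its mean, of order \<open>e powr q\<close>, suffices.\<close>
  have pointwise: "?w x powr q \<le> (4 * s) powr q * (?g t1 x powr q) + (4 * s) powr q * (?g t2 x powr q)
    + 4 powr q * W powr (q - 1) * ?d x" for x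
  proof -
    have d: "0 \<le> ?d x" "?d x \<le> W"
      using f(2)[of "X x - c"] f(2)[of "X x + c"] f(1) c0 by (auto simp: monoD)
    have g: "?g t x > 0" for t using gap_ge_1[of t 0 1 "U x"] by simp
    have sg: "s * ?g t x \<ge> 0" for t using s0 g[of t] by simp
    have w0: "0 \<le> ?w x" using t1(3)[of x] t2(4)[of x] d by linarith
    have "?w x \<le> s * ?g t2 x + (s * ?g t1 x + ?d x)"
      using t1(4)[of x] t2(3)[of x] by (simp add: distrib_left)
    then have "?w x powr q \<le> (s * ?g t2 x + (s * ?g t1 x + ?d x)) powr q"
      using w0 q0 by (intro powr_mono2) auto
    also have "\<dots> \<le> (2 * (s * ?g t2 x)) powr q + (2 * (s * ?g t1 x + ?d x)) powr q"
      using sg d q0 by (intro add_powr_le) (simp_all add: add_nonneg_nonneg)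
    also have "(2 * (s * ?g t1 x + ?d x)) powr q = (2 * (s * ?g t1 x) + 2 * ?d x) powr q"
      by (simp add: distrib_left)
    also have "\<dots> \<le> (2 * (2 * (s * ?g t1 x))) powr q + (2 * (2 * ?d x)) powr q"
      using s0 g d q0 by (intro add_powr_le) (auto intro!: mult_nonneg_nonneg less_imp_le)
    \<comment> \<open>The constant is enlarged from 2 to 4 so that both gap terms carry the same
      factor.\<close>
    also have "(2 * (s * ?g t2 x)) powr q \<le> (4 * s * ?g t2 x) powr q"
      using s0 g q0 by (intro powr_mono2) (auto intro!: mult_nonneg_nonneg less_imp_le)
    also have "(2 * (2 * ?d x)) powr q = 4 powr q * ?d x powr q"
      using d powr_mult[of 4 "?d x" q] by simp
    also have "\<dots> \<le> 4 powr q * (W powr (q - 1) * ?d x)"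
    proof (cases "?d x = 0")
      case False
      have "?d x powr q = ?d x powr (q - 1) * ?d x powr 1"
        by (simp only: powr_add[symmetric]) simp
      also have "\<dots> = ?d x powr (q - 1) * ?d x" using False d by simp
      also have "\<dots> \<le> W powr (q - 1) * ?d x"
        using d q by (intro mult_right_mono powr_mono2) auto
      finally show ?thesis by (intro mult_left_mono) auto
    qed simp
    finally show ?thesis using s0 g[of t1] g[of t2] powr_mult[of "4 * s" "?g t1 x" q] powr_mult[of "4 * s" "?g t2 x" q]
      by (simp add: mult.assoc)
  qed
  have nn: "4 powr q * W powr (q - 1) \<ge> 0" "(4 * s) powr q \<ge> 0" by auto
  have C: "cost_const q \<ge> 0" using t1(2) cost_nonneg[of 1 q t1] by simp
  have "(\<integral>\<^sup>+x. ennreal (?w x powr q) \<partial>M) \<le>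
    (\<integral>\<^sup>+x. ennreal ((4 * s) powr q) * ennreal (?g t1 x powr q) + ennreal ((4 * s) powr q) * ennreal (?g t2 x powr q)
      + ennreal (4 powr q * W powr (q - 1)) * ennreal (?d x) \<partial>M)"
  proof (rule nn_integral_mono)
    fix x
    have d: "0 \<le> ?d x" using f(1) c0 by (auto simp: monoD)
    show "ennreal (?w x powr q) \<le> ennreal ((4 * s) powr q) * ennreal (?g t1 x powr q) + ennreal ((4 * s) powr q) * ennreal (?g t2 x powr q)
      + ennreal (4 powr q * W powr (q - 1)) * ennreal (?d x)"
      using ennreal_leI[OF pointwise[of x]] d
      by (simp add: ennreal_mult ennreal_plus)
  qed
  also have "\<dots> = ennreal ((4 * s) powr q) * (\<integral>\<^sup>+x. ennreal (?g t1 x powr q) \<partial>M)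
    + ennreal ((4 * s) powr q) * (\<integral>\<^sup>+x. ennreal (?g t2 x powr q) \<partial>M)
    + ennreal (4 powr q * W powr (q - 1)) * (\<integral>\<^sup>+x. ennreal (?d x) \<partial>M)"
    by (simp add: nn_integral_add nn_integral_cmult)
  also have "\<dots> \<le> ennreal ((4 * s) powr q) * ennreal (2 * cost_const q)
    + ennreal ((4 * s) powr q) * ennreal (2 * cost_const q)
    + ennreal (4 powr q * W powr (q - 1)) * ennreal (2 * c * L * W)"
    by (intro add_mono mult_left_mono gap_int t1 t2 nn_integral_mono_shift_le X L f c0) auto
  also have "\<dots> = ennreal ((4 * s) powr q * (4 * cost_const q) + 4 powr q * W powr (q - 1) * (2 * c * L * W))"
    using C L c0 W by (simp add: ennreal_mult[symmetric] ennreal_plus[symmetric] del: ennreal_plus)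
  also have "\<dots> \<le> ennreal ((4 * W) powr q * 4 * (cost_const q + L) * e powr q)"
  proof (rule ennreal_leI)
    \<comment> \<open>The mesh \<open>s\<close> is at most \<open>W * e\<close>, so both error terms
      become multiples of \<open>e powr q\<close>.\<close>
    have "4 * s \<le> 4 * W * e" using e W mult_left_mono[OF e, of "4 * W"] by (simp add: s_def)
    then have "(4 * s) powr q \<le> (4 * W * e) powr q" using s0 q0 by (intro powr_mono2) auto
    then have A: "(4 * s) powr q * (4 * cost_const q) \<le> (4 * W) powr q * e powr q * (4 * cost_const q)"
      using C e0 W powr_mult[of "4 * W" e q] by (intro mult_right_mono) auto
    have "W powr q = W powr (q - 1) * W powr 1" by (simp only: powr_add[symmetric]) simp
    then have "W powr (q - 1) * W = W powr q" using W by simp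
    then have "4 powr q * W powr (q - 1) * (2 * c * L * W) = 4 powr q * W powr q * (4 * L) * e powr q"
      by (simp add: c_def algebra_simps)
    also have "\<dots> = (4 * W) powr q * (4 * L) * e powr q" using W powr_mult[of 4 W q] by simp
    finally have B: "4 powr q * W powr (q - 1) * (2 * c * L * W) = (4 * W) powr q * (4 * L) * e powr q" .
    show "(4 * s) powr q * (4 * cost_const q) + 4 powr q * W powr (q - 1) * (2 * c * L * W)
      \<le> (4 * W) powr q * 4 * (cost_const q + L) * e powr q"
      unfolding B using A by (simp add: algebra_simps)
  qed
  finally show ?thesis using t1 t2 unfolding c_def by blast
qed

section \<open>Covering numbers, bracketing numbers and the choice of scale\<close>

lemma ln_enat_mono: "m \<le> n \<Longrightarrow> ln_enat m \<le> ln_enat n"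
  by (cases m; cases n) (auto simp: ln_enat_def)

lemma sup_norm_less_imp:
  assumes "sup_norm S f < ennreal e" and "x \<in> S"
  shows "\<bar>f x\<bar> < e"
proof -
  have "ennreal \<bar>f x\<bar> \<le> sup_norm S f" unfolding sup_norm_def using assms(2) by (rule SUP_upper)
  then have "ennreal \<bar>f x\<bar> < ennreal e" using assms(1) by (rule le_less_trans)
  then show ?thesis by (simp add: ennreal_less_iff)
qed

text \<open>The least \<open>k\<close> with \<open>1 / e \<le> 2 ^ k\<close>: the mesh is fine
  enough, and minimality keeps the size of the trees of order \<open>1 / e\<close>.\<close>

lemma dyadic_scale:
  fixes e :: real
  assumes "0 < e" "e \<le> 1"
  obtains k :: nat where "1 / 2 ^ k \<le> e" "2 ^ k \<le> 2 / e"
proof -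
  obtain n where "1 / e < 2 ^ n" using real_arch_pow[of 2 "1 / e"] by auto
  then have ex: "1 / e \<le> 2 ^ n" by simp
  define k where "k = (LEAST n. 1 / e \<le> 2 ^ n)"
  have k: "1 / e \<le> 2 ^ k" unfolding k_def using ex by (rule LeastI)
  have "2 ^ k \<le> 2 / e"
  proof (cases k)
    case 0
    then show ?thesis using assms by simp
  next
    case (Suc j)
    then have "\<not> 1 / e \<le> 2 ^ j" using not_less_Least[of j "\<lambda>n. 1 / e \<le> 2 ^ n"] by (simp add: k_def)
    then show ?thesis using Suc by simp
  qed
  with k show ?thesis using assms by (intro that[of k]) (auto simp: field_simps)
qed

text \<open>Pairs in \<open>B\<close> that are not admissible brackets are discarded without raising
  the count. This permits counting all codes, whether or not they arise from a function.\<close>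

lemma bracketing_number_le:
  assumes "finite B"
    and "\<And>f. f \<in> F \<Longrightarrow> \<exists>(l, u)\<in>B. l \<in> Lq_space q P \<and> u \<in> Lq_space q P \<and>
      Lq_norm q P (\<lambda>x. u x - l x) < e \<and> (\<forall>x\<in>space P. l x \<le> f x \<and> f x \<le> u x)"
  shows "bracketing_number_Lq q P e F \<le> enat (card B)"
proof -
  let ?B = "{(l, u). (l, u) \<in> B \<and> l \<in> Lq_space q P \<and> u \<in> Lq_space q P \<and> Lq_norm q P (\<lambda>x. u x - l x) < e}"
  have sub: "?B \<subseteq> B" by auto
  have "bracketing_number_Lq q P e F \<le> enat (card ?B)"
    unfolding bracketing_number_Lq_def
  proof (rule INF_lower, intro CollectI conjI ballI)
    show "finite ?B" using sub assms(1) by (rule finite_subset)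
    fix f assume "f \<in> F"
    from assms(2)[OF this] obtain l u where "(l, u) \<in> ?B" "\<forall>x\<in>space P. l x \<le> f x \<and> f x \<le> u x"
      by blast
    then show "\<exists>(l, u)\<in>?B. \<forall>x\<in>space P. l x \<le> f x \<and> f x \<le> u x"
      by (intro bexI[of _ "(l, u)"]) auto
  qed auto
  also have "\<dots> \<le> enat (card B)" using card_mono[OF assms(1) sub] by simp
  finally show ?thesis .
qed

text \<open>Extended naturals are well-ordered, so the infimum is a minimum unless no finite cover
  exists.\<close>

lemma covering_number_attained:
  assumes "covering_number_sup S e F \<noteq> \<infinity>"
  obtains A where "finite A" "\<And>f. f \<in> F \<Longrightarrow> \<exists>c\<in>A. sup_norm S (\<lambda>x. f x - c x) < ennreal e"
    "covering_number_sup S e F = enat (card A)"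
proof -
  let ?C = "{A. finite A \<and> (\<forall>c\<in>A. sup_norm S c < \<infinity>) \<and> (\<forall>f\<in>F. \<exists>c\<in>A. sup_norm S (\<lambda>x. f x - c x) < ennreal e)}"
  have "?C \<noteq> {}"
  proof
    assume "?C = {}"
    then show False using assms unfolding covering_number_sup_def by (simp only: image_empty Inf_enat_def) simp
  qed
  then obtain A0 where "A0 \<in> ?C" by blast
  then have "Inf ((\<lambda>A. enat (card A)) ` ?C) \<in> (\<lambda>A. enat (card A)) ` ?C"
    by (intro wellorder_InfI[of "enat (card A0)"] imageI)
  then obtain A where A: "A \<in> ?C" "covering_number_sup S e F = enat (card A)"
    unfolding covering_number_sup_def by (rule imageE)
  show ?thesis
  proof (rule that[of A])
    show "\<exists>c\<in>A. sup_norm S (\<lambda>x. f x - c x) < ennreal e" if "f \<in> F" for f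
      using A(1) that by blast
  qed (use A in auto)
qed

section \<open>Brackets for differences of monotone functions, and their number\<close>

definition bracket_const :: "real \<Rightarrow> real \<Rightarrow> real \<Rightarrow> real" where
  "bracket_const q L W = 2 powr q * 2 * ((4 * W) powr q * 4 * (cost_const q + L))"

text \<open>The trees \<open>t1\<close> and \<open>t2\<close> give the ends for the first monotone
  part, \<open>t3\<close> and \<open>t4\<close> those for the second. Subtraction pairs the lower
  end of one part with the upper end of the other.\<close>

definition step_bracket ::
  "real \<Rightarrow> ('a \<Rightarrow> real) \<Rightarrow> dyadic \<times> dyadic \<times> dyadic \<times> dyadic \<Rightarrow> ('a \<Rightarrow> real) \<times> ('a \<Rightarrow> real)" where
  "step_bracket s U = (\<lambda>(t1, t2, t3, t4).
     (\<lambda>x. s * lower t1 0 1 (U x) - s * (lower t4 0 1 (U x) + gap t4 0 1 (U x)),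
      \<lambda>x. s * (lower t2 0 1 (U x) + gap t2 0 1 (U x)) - s * lower t3 0 1 (U x)))"

text \<open>The last clause concerns all reals \<open>y\<close> near \<open>X x\<close>, so one
  bracket serves every inner function within \<open>2 * e powr q\<close> of \<open>X\<close>. The
  set \<open>T\<close> depends only on \<open>q\<close> and \<open>k\<close>, so the trees can be
  counted independently of the functions.\<close>

lemma (in prob_space) composition_bracket:
  fixes X :: "'a \<Rightarrow> real" and k :: nat
  assumes X [measurable]: "X \<in> borel_measurable M" and L: "L > 0" "has_density_bounded_by M X L"
    and f: "mono f" "\<And>y. f y \<in> {0..W}" and g: "mono g" "\<And>y. g y \<in> {0..W}"
    and W: "W > 0" and q: "q \<ge> 1" and e: "1 / 2 ^ k \<le> e"
  defines "s \<equiv> W / 2 ^ k" and "U \<equiv> \<lambda>x. cdf (distr M borel X) (X x) / 2"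
  defines "T \<equiv> {t. real (weight t) \<le> (3 + 2 * chain_const q) * 2 ^ k}"
  shows "\<exists>t \<in> T \<times> T \<times> T \<times> T. \<exists>l u. step_bracket s U t = (l, u) \<and>
    l \<in> Lq_space q M \<and> u \<in> Lq_space q M \<and>
    Lq_norm q M (\<lambda>x. u x - l x) \<le> bracket_const q L W powr (1 / q) * e \<and>
    (\<forall>x y. \<bar>y - X x\<bar> \<le> 2 * e powr q \<longrightarrow> l x \<le> f y - g y \<and> f y - g y \<le> u x)"
proof -
  define c where "c = 2 * e powr q"
  define J where "J = (4 * W) powr q * 4 * (cost_const q + L)"
  have "0 < 1 / (2::real) ^ k" by simp
  then have e0: "e > 0" using e by linarith
  have s0: "s > 0" using W by (simp add: s_def)
  have q0: "q > 0" using q by simp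
  let ?F = "cdf (distr M borel X)"
  interpret D: real_distribution "distr M borel X" by (rule real_distribution_distr) fact
  have [measurable]: "?F \<in> borel_measurable borel"
    using D.cdf_nondecreasing by (intro borel_measurable_mono monoI)
  have [measurable]: "U \<in> borel_measurable M" unfolding U_def by measurable
  let ?lo = "\<lambda>t x. s * lower t 0 1 (U x)"
  let ?up = "\<lambda>t x. s * (lower t 0 1 (U x) + gap t 0 1 (U x))"
  have conc: "prob {x \<in> space M. a \<le> X x \<and> X x \<le> b} \<le> L * (b - a)" if "a \<le> b" for a b
    using prob_between_le_if_density_bounded[OF L(2) _ that] L(1) by simp
  obtain t1 t2 where t: "t1 \<in> T" "t2 \<in> T" "\<And>x. ?lo t1 x \<le> f (X x - c)" "\<And>x. f (X x + c) \<le> ?up t2 x"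
    "(\<integral>\<^sup>+x. ennreal ((?up t2 x - ?lo t1 x) powr q) \<partial>M) \<le> ennreal (J * e powr q)"
    using mono_bracket[OF X less_imp_le[OF L(1)] conc f W q e] unfolding s_def U_def T_def c_def J_def by blast
  obtain t3 t4 where t': "t3 \<in> T" "t4 \<in> T" "\<And>x. ?lo t3 x \<le> g (X x - c)" "\<And>x. g (X x + c) \<le> ?up t4 x"
    "(\<integral>\<^sup>+x. ennreal ((?up t4 x - ?lo t3 x) powr q) \<partial>M) \<le> ennreal (J * e powr q)"
    using mono_bracket[OF X less_imp_le[OF L(1)] conc g W q e] unfolding s_def U_def T_def c_def J_def by blast
  define l where "l x = ?lo t1 x - ?up t4 x" for x
  define u where "u x = ?up t2 x - ?lo t3 x" for x
  have [measurable]: "l \<in> borel_measurable M" "u \<in> borel_measurable M"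
    unfolding l_def u_def by measurable
  have lo: "0 \<le> ?lo t x" "?lo t x \<le> s * weight t" for t x
    using s0 lower_nonneg[of t 0 1 "U x"] lower_le_weight[of t 0 1 "U x"] by auto
  have up: "0 \<le> ?up t x" "?up t x \<le> s * (2 * weight t)" for t x
  proof -
    have "0 \<le> lower t 0 1 (U x) + gap t 0 1 (U x)"
      using lower_nonneg[of t 0 1 "U x"] gap_ge_1[of t 0 1 "U x"] by linarith
    then show "0 \<le> ?up t x" using s0 by simp
    have "lower t 0 1 (U x) + gap t 0 1 (U x) \<le> 2 * weight t"
      using lower_le_weight[of t 0 1 "U x"] gap_le_weight[of t 0 1 "U x"] by linarith
    then show "?up t x \<le> s * (2 * weight t)" using s0 by (intro mult_left_mono) auto
  qed
  have Lq: "l \<in> Lq_space q M" "u \<in> Lq_space q M"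
  proof -
    have "\<bar>l x\<bar> \<le> s * weight t1 + s * (2 * weight t4)" for x
      unfolding l_def using lo[of t1 x] up[of t4 x] by linarith
    then show "l \<in> Lq_space q M" using q0 by (intro bounded_in_Lq_space) auto
    have "\<bar>u x\<bar> \<le> s * (2 * weight t2) + s * weight t3" for x
      unfolding u_def using lo[of t3 x] up[of t2 x] by linarith
    then show "u \<in> Lq_space q M" using q0 by (intro bounded_in_Lq_space) auto
  qed
  have c0: "c \<ge> 0" by (simp add: c_def)
  have width: "0 \<le> ?up t2 x - ?lo t1 x" "0 \<le> ?up t4 x - ?lo t3 x" for x
    using t(3,4)[of x] t'(3,4)[of x] monoD[OF f(1), of "X x - c" "X x + c"] monoD[OF g(1), of "X x - c" "X x + c"] c0
    by linarith+
  have "cost_const q \<ge> 0" using chain_const(1)[OF q0] by (simp add: cost_const_def)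
  then have J0: "J \<ge> 0" using L by (simp add: J_def)
  have "(\<integral>\<^sup>+x. ennreal (\<bar>u x - l x\<bar> powr q) \<partial>M) \<le>
    (\<integral>\<^sup>+x. ennreal (2 powr q) * ennreal ((?up t2 x - ?lo t1 x) powr q) +
      ennreal (2 powr q) * ennreal ((?up t4 x - ?lo t3 x) powr q) \<partial>M)"
  proof (rule nn_integral_mono)
    fix x
    \<comment> \<open>The width is the sum of the widths for the two monotone parts, which produces
      the factors \<open>2 powr q\<close> and 2 in \<open>bracket_const\<close>.\<close>
    have "\<bar>u x - l x\<bar> = (?up t2 x - ?lo t1 x) + (?up t4 x - ?lo t3 x)"
      using width[of x] unfolding u_def l_def by linarith
    also have "\<dots> powr q \<le> (2 * (?up t2 x - ?lo t1 x)) powr q + (2 * (?up t4 x - ?lo t3 x)) powr q"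
      using width[of x] q0 by (rule add_powr_le)
    also have "\<dots> = 2 powr q * (?up t2 x - ?lo t1 x) powr q + 2 powr q * (?up t4 x - ?lo t3 x) powr q"
      by (simp only: powr_mult)
    finally show "ennreal (\<bar>u x - l x\<bar> powr q) \<le> ennreal (2 powr q) * ennreal ((?up t2 x - ?lo t1 x) powr q) +
      ennreal (2 powr q) * ennreal ((?up t4 x - ?lo t3 x) powr q)"
      by (simp add: ennreal_mult[symmetric] ennreal_plus[symmetric] ennreal_leI del: ennreal_plus)
  qed
  also have "\<dots> = ennreal (2 powr q) * (\<integral>\<^sup>+x. ennreal ((?up t2 x - ?lo t1 x) powr q) \<partial>M) +
      ennreal (2 powr q) * (\<integral>\<^sup>+x. ennreal ((?up t4 x - ?lo t3 x) powr q) \<partial>M)"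
    by (simp add: nn_integral_add nn_integral_cmult)
  also have "\<dots> \<le> ennreal (2 powr q) * ennreal (J * e powr q) + ennreal (2 powr q) * ennreal (J * e powr q)"
    by (intro add_mono mult_left_mono t t') auto
  also have "\<dots> = ennreal (bracket_const q L W * e powr q)"
    using J0 by (simp add: ennreal_mult[symmetric] ennreal_plus[symmetric] bracket_const_def J_def[symmetric] del: ennreal_plus)
  finally have int: "(\<integral>\<^sup>+x. ennreal (\<bar>u x - l x\<bar> powr q) \<partial>M) \<le> ennreal (bracket_const q L W * e powr q)" .
  have K0: "bracket_const q L W \<ge> 0" using J0 by (simp add: bracket_const_def J_def[symmetric])
  then have "Lq_norm q M (\<lambda>x. u x - l x) \<le> (bracket_const q L W * e powr q) powr (1 / q)"
    using int q0 by (intro Lq_norm_le) auto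
  also have "\<dots> = bracket_const q L W powr (1 / q) * e"
    using K0 e0 q0 powr_mult[of "bracket_const q L W" "e powr q" "1 / q"] by (simp add: powr_powr)
  finally have norm: "Lq_norm q M (\<lambda>x. u x - l x) \<le> bracket_const q L W powr (1 / q) * e" .
  have between: "l x \<le> f y - g y \<and> f y - g y \<le> u x" if "\<bar>y - X x\<bar> \<le> 2 * e powr q" for x y
  proof -
    have "X x - c \<le> y" "y \<le> X x + c" using that by (auto simp: c_def abs_le_iff)
    then have "f (X x - c) \<le> f y" "f y \<le> f (X x + c)" "g (X x - c) \<le> g y" "g y \<le> g (X x + c)"
      using f(1) g(1) by (auto dest: monoD)
    then show ?thesis unfolding l_def u_def using t(3,4)[of x] t'(3,4)[of x] by linarith
  qed
  have "step_bracket s U (t1, t2, t3, t4) = (l, u)"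
    by (simp add: step_bracket_def l_def[abs_def] u_def[abs_def])
  then have "\<exists>l u. step_bracket s U (t1, t2, t3, t4) = (l, u) \<and>
    l \<in> Lq_space q M \<and> u \<in> Lq_space q M \<and>
    Lq_norm q M (\<lambda>x. u x - l x) \<le> bracket_const q L W powr (1 / q) * e \<and>
    (\<forall>x y. \<bar>y - X x\<bar> \<le> 2 * e powr q \<longrightarrow> l x \<le> f y - g y \<and> f y - g y \<le> u x)"
    using Lq norm between by blast
  then show ?thesis using t(1,2) t'(1,2) by (intro bexI[of _ "(t1, t2, t3, t4)"]) auto
qed

text \<open>With \<open>2 \<le> exp 1\<close>, the count \<open>2 ^ (2 * m + 1)\<close> gives the
  exponent \<open>2 * m + 1\<close>, where \<open>m\<close> is at most
  \<open>(3 + 2 * chain_const q) * (2 / e)\<close>. The final 1 is absorbed by \<open>1 / e\<close>,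
  so 13 is 12 + 1.\<close>

lemma card_dyadic_le:
  fixes e :: real
  assumes q: "q > 0" and e: "0 < e" "e \<le> 1" "2 ^ k \<le> 2 / e"
  defines "T \<equiv> {t. real (weight t) \<le> (3 + 2 * chain_const q) * 2 ^ k}"
  shows "finite T" and "T \<noteq> {}" and "real (card T) \<le> exp ((13 + 8 * chain_const q) / e)"
proof -
  let ?r = "(3 + 2 * chain_const q) * 2 ^ k"
  have D: "chain_const q > 0" using chain_const q by simp
  have T: "T = {t. weight t \<le> nat \<lfloor>?r\<rfloor>}"
    using D by (auto simp: T_def le_nat_floor le_nat_iff le_floor_iff)
  show "finite T" unfolding T by (rule finite_card_weight_le)
  have "1 * 1 \<le> (3 + 2 * chain_const q) * 2 ^ k" using D by (intro mult_mono) auto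
  then have "Leaf 0 \<in> T" by (simp add: T_def)
  then show "T \<noteq> {}" by blast
  have "real (card T) \<le> real (2 ^ (2 * nat \<lfloor>?r\<rfloor> + 1))"
    unfolding T of_nat_le_iff by (rule finite_card_weight_le)
  also have "\<dots> \<le> exp 1 ^ (2 * nat \<lfloor>?r\<rfloor> + 1)"
    using exp_ge_add_one_self[of 1] by (simp only: of_nat_power) (intro power_mono; simp)
  also have "\<dots> = exp (2 * real (nat \<lfloor>?r\<rfloor>) + 1)"
    using exp_of_nat_mult[of "2 * nat \<lfloor>?r\<rfloor> + 1" "1::real"] by (simp add: add.commute)
  also have "\<dots> \<le> exp ((13 + 8 * chain_const q) / e)"
  proof -
    have "real (nat \<lfloor>?r\<rfloor>) \<le> ?r" using D by (intro of_nat_floor) simp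
    also have "\<dots> \<le> (3 + 2 * chain_const q) * (2 / e)" using e D by (intro mult_left_mono) auto
    finally have "real (nat \<lfloor>?r\<rfloor>) \<le> (3 + 2 * chain_const q) * (2 / e)" .
    moreover have "1 \<le> 1 / e" using e by simp
    ultimately have "2 * real (nat \<lfloor>?r\<rfloor>) + 1 \<le> 2 * ((3 + 2 * chain_const q) * (2 / e)) + 1 / e"
      by linarith
    also have "\<dots> = (13 + 8 * chain_const q) / e" using e by (simp add: field_simps)
    finally show ?thesis by simp
  qed
  finally show "real (card T) \<le> exp ((13 + 8 * chain_const q) / e)" .
qed

section \<open>The entropy bound for compositions\<close>

theorem lemmaA1:
  fixes q M V :: real
  assumes "q \<ge> 1" and "M > 0"
  shows "\<exists>C1>0. \<exists>C2>0.
    \<forall>(d :: nat) (P :: (nat \<Rightarrow> real) measure) (\<Lambda> :: ((nat \<Rightarrow> real) \<Rightarrow> real) set)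
      (\<T> :: (real \<Rightarrow> real) set) (\<epsilon> :: real).
      prob_space P \<and> sets P = sets (borel_vec d) \<and>
      (\<forall>\<phi>\<in>\<Lambda>. \<phi> \<in> borel_measurable P \<and> has_density_bounded_by P \<phi> M) \<and>
      (\<forall>\<tau>\<in>\<T>. total_variation \<tau> \<le> ennreal V \<and> (\<forall>y. \<tau> y \<in> {-M..M})) \<and>
      \<epsilon> > 0 \<longrightarrow>
      ln_enat (bracketing_number_Lq q P (C2 * \<epsilon>) {\<tau> \<circ> \<phi> | \<tau> \<phi>. \<tau> \<in> \<T> \<and> \<phi> \<in> \<Lambda>})
        \<le> ln_enat (covering_number_sup (space P) (\<epsilon> powr q) \<Lambda>) + ereal (C1 / \<epsilon>)"
proof -
  \<comment> \<open>The range of the monotone parts in the Jordan decomposition.\<close>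
  define W where "W = max 0 V + 2 * M"
  \<comment> \<open>The factor 4 counts the trees in a bracket.\<close>
  define C1 where "C1 = 4 * (13 + 8 * chain_const q)"
  \<comment> \<open>The first summand serves \<open>e \<le> 1\<close>, the second the trivial
    bracket for \<open>e > 1\<close>; the 1 makes the size inequalities strict.\<close>
  define C2 where "C2 = bracket_const q M W powr (1 / q) + 2 * M + 1"
  have q0: "q > 0" and W0: "W > 0" using assms by (auto simp: W_def)
  have C1: "C1 > 0" using chain_const(1)[OF q0] by (simp add: C1_def)
  have C2: "C2 > 2 * M" "C2 > bracket_const q M W powr (1 / q)" "C2 > 0" using assms
    by (auto simp: C2_def intro!: add_nonneg_pos)
  have main: "ln_enat (bracketing_number_Lq q P (C2 * e) {\<tau> \<circ> \<phi> | \<tau> \<phi>. \<tau> \<in> \<T> \<and> \<phi> \<in> \<Lambda>})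
      \<le> ln_enat (covering_number_sup (space P) (e powr q) \<Lambda>) + ereal (C1 / e)"
    if "prob_space P" and meas: "\<And>\<phi>. \<phi> \<in> \<Lambda> \<Longrightarrow> \<phi> \<in> borel_measurable P"
      and dens: "\<And>\<phi>. \<phi> \<in> \<Lambda> \<Longrightarrow> has_density_bounded_by P \<phi> M"
      and tv: "\<And>\<tau>. \<tau> \<in> \<T> \<Longrightarrow> total_variation \<tau> \<le> ennreal V" "\<And>\<tau> y. \<tau> \<in> \<T> \<Longrightarrow> \<tau> y \<in> {-M..M}"
      and e: "e > 0"
    for P :: "(nat \<Rightarrow> real) measure" and \<Lambda> \<T> e
  proof (cases "covering_number_sup (space P) (e powr q) \<Lambda> = \<infinity>")
    case True
    then show ?thesis by (simp add: ln_enat_def)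
  next
    case False
    interpret prob_space P by fact
    let ?G = "{\<tau> \<circ> \<phi> | \<tau> \<phi>. \<tau> \<in> \<T> \<and> \<phi> \<in> \<Lambda>}"
    let ?N = "bracketing_number_Lq q P (C2 * e) ?G"
    obtain A where A: "finite A" "\<And>\<phi>. \<phi> \<in> \<Lambda> \<Longrightarrow> \<exists>c\<in>A. sup_norm (space P) (\<lambda>x. \<phi> x - c x) < ennreal (e powr q)"
      "covering_number_sup (space P) (e powr q) \<Lambda> = enat (card A)"
      using covering_number_attained[OF False] by metis
    show ?thesis
    \<comment> \<open>For an empty class the left side is minus infinity. Otherwise every cover is
      nonempty, so its logarithm is finite and nonnegative.\<close>
    proof (cases "\<Lambda> = {}")
      case True
      have "?N \<le> enat (card ({} :: (((nat \<Rightarrow> real) \<Rightarrow> real) \<times> ((nat \<Rightarrow> real) \<Rightarrow> real)) set))"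
        by (rule bracketing_number_le) (use True in auto)
      then have "?N = 0" by (simp add: zero_enat_def[symmetric])
      then show ?thesis by (simp add: ln_enat_def zero_enat_def)
    next
      case False
      then have "A \<noteq> {}" using A(2) by auto
      then have cA: "card A > 0" using A(1) by (simp add: card_gt_0_iff)
      consider "e > 1" | "e \<le> 1" by linarith
      then show ?thesis
      proof cases
        case 1
        \<comment> \<open>For \<open>e > 1\<close> a single constant bracket of width
          \<open>2 * M\<close> contains the whole class, and its logarithmic count is 0.\<close>
        let ?b = "(\<lambda>_ :: nat \<Rightarrow> real. - M, \<lambda>_ :: nat \<Rightarrow> real. M)"
        have "?N \<le> enat (card {?b})"
        proof (rule bracketing_number_le)
          have "Lq_norm q P (\<lambda>x. M - - M) = 2 * M"
            using assms q0 prob_space by (simp add: Lq_norm_def powr_powr)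
          also have "\<dots> < C2 * e" using C2 1 mult_strict_left_mono[of 1 e C2] by linarith
          finally have n: "Lq_norm q P (\<lambda>x. M - - M) < C2 * e" .
          have Lq: "(\<lambda>_. r) \<in> Lq_space q P" for r using q0 by (intro bounded_in_Lq_space[of _ "\<bar>r\<bar>"]) auto
          fix h assume "h \<in> ?G"
          then have "\<forall>x. - M \<le> h x \<and> h x \<le> M" using tv(2) by fastforce
          then show "\<exists>(l, u)\<in>{?b}. l \<in> Lq_space q P \<and> u \<in> Lq_space q P \<and>
            Lq_norm q P (\<lambda>x. u x - l x) < C2 * e \<and> (\<forall>x\<in>space P. l x \<le> h x \<and> h x \<le> u x)"
            using n Lq by auto
        qed simp
        then have "ln_enat ?N \<le> ln_enat (enat (card {?b}))" by (rule ln_enat_mono)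
        also have "\<dots> = ereal 0" by (simp add: ln_enat_def)
        also have "\<dots> \<le> ereal (ln (real (card A)) + C1 / e)"
          using cA C1 e by simp
        finally show ?thesis using cA by (simp add: A(3) ln_enat_def)
      next
        case 2
        obtain k :: nat where k: "1 / 2 ^ k \<le> e" "2 ^ k \<le> 2 / e" using dyadic_scale[OF e 2] .
        define T where "T = {t. real (weight t) \<le> (3 + 2 * chain_const q) * 2 ^ k}"
        note T = card_dyadic_le[OF q0 e 2 k(2), folded T_def]
        have cT: "card T > 0" using T by (simp add: card_gt_0_iff)
        then have lnT: "ln (real (card T)) \<le> (13 + 8 * chain_const q) / e"
          using T(3) using ln_le_cancel_iff[of "real (card T)" "exp ((13 + 8 * chain_const q) / e)"] by simp
        \<comment> \<open>Cover centers need not have a density, so they are replaced by members of the class;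
          this doubles the radius.\<close>
        define rep where "rep c = (SOME \<phi>. \<phi> \<in> \<Lambda> \<and> sup_norm (space P) (\<lambda>x. \<phi> x - c x) < ennreal (e powr q))" for c
        define s where "s = W / 2 ^ k"
        define U where "U c x = cdf (distr P borel (rep c)) (rep c x) / 2" for c x
        \<comment> \<open>A bracket is determined by a centre and four trees, so the logarithm of
          the count splits into the covering term and four tree terms.\<close>
        define br where "br = (\<lambda>(c, t). step_bracket s (U c) t)"
        let ?I = "A \<times> T \<times> T \<times> T \<times> T"
        have finI: "finite ?I" using A(1) T(1) by simp
        have "?N \<le> enat (card (br ` ?I))"
        proof (rule bracketing_number_le)
          show "finite (br ` ?I)" using finI by simp
          fix h assume "h \<in> ?G"
          then obtain \<tau> \<phi> where h: "h = \<tau> \<circ> \<phi>" "\<tau> \<in> \<T>" "\<phi> \<in> \<Lambda>" by auto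
          obtain f g where fg: "mono f" "mono g" "\<And>y. f y \<in> {0..W}" "\<And>y. g y \<in> {0..W}" "\<And>y. \<tau> y = f y - g y"
            using total_variation_imp_diff_mono[OF tv(1)[OF h(2)] tv(2)[OF h(2)]] unfolding W_def by blast
          obtain c where c: "c \<in> A" "sup_norm (space P) (\<lambda>x. \<phi> x - c x) < ennreal (e powr q)"
            using A(2) h(3) by blast
          have rep: "rep c \<in> \<Lambda> \<and> sup_norm (space P) (\<lambda>x. rep c x - c x) < ennreal (e powr q)"
            unfolding rep_def by (rule someI[of _ \<phi>]) (use c h in auto)
          have close: "\<bar>\<phi> x - rep c x\<bar> \<le> 2 * e powr q" if "x \<in> space P" for x
            using sup_norm_less_imp[OF c(2) that] sup_norm_less_imp[OF conjunct2[OF rep] that] by linarith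
          obtain t l u where t: "t \<in> T \<times> T \<times> T \<times> T"
            and lu: "step_bracket s (U c) t = (l, u)" "l \<in> Lq_space q P" "u \<in> Lq_space q P"
              "Lq_norm q P (\<lambda>x. u x - l x) \<le> bracket_const q M W powr (1 / q) * e"
              "\<forall>x y. \<bar>y - rep c x\<bar> \<le> 2 * e powr q \<longrightarrow> l x \<le> f y - g y \<and> f y - g y \<le> u x"
            using composition_bracket[OF meas[OF conjunct1[OF rep]] assms(2) dens[OF conjunct1[OF rep]]
                fg(1,3,2,4) W0 assms(1) k(1)]
            unfolding T_def[symmetric] s_def[symmetric] U_def[symmetric] by blast
          have "bracket_const q M W powr (1 / q) * e < C2 * e" using C2(2) e by simp
          then have "Lq_norm q P (\<lambda>x. u x - l x) < C2 * e" using lu(4) by linarith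
          moreover have "\<forall>x\<in>space P. l x \<le> h x \<and> h x \<le> u x" using lu(5) close by (simp add: h(1) fg(5))
          moreover have "(l, u) \<in> br ` ?I" using c(1) t by (intro image_eqI[of _ _ "(c, t)"]) (auto simp: br_def lu(1))
          ultimately show "\<exists>(l, u)\<in>br ` ?I. l \<in> Lq_space q P \<and> u \<in> Lq_space q P \<and>
            Lq_norm q P (\<lambda>x. u x - l x) < C2 * e \<and> (\<forall>x\<in>space P. l x \<le> h x \<and> h x \<le> u x)"
            using lu(2,3) by blast
        qed
        also have "\<dots> \<le> enat (card ?I)" using card_image_le[OF finI, of br] by simp
        also have "card ?I = card A * card T ^ 4" by (simp add: card_cartesian_product power4_eq_xxxx)
        finally have "ln_enat ?N \<le> ln_enat (enat (card A * card T ^ 4))" by (rule ln_enat_mono)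
        also have "\<dots> = ereal (ln (real (card A)) + 4 * ln (real (card T)))"
        proof -
          have "ln (real (card A * card T ^ 4)) = ln (real (card A)) + ln (real (card T) ^ 4)"
            using cA cT by (simp add: ln_mult)
          also have "ln (real (card T) ^ 4) = 4 * ln (real (card T))"
            using ln_realpow[of "real (card T)" 4] by simp
          finally show ?thesis using cA cT by (simp add: ln_enat_def)
        qed
        also have "\<dots> \<le> ereal (ln (real (card A)) + 4 * ((13 + 8 * chain_const q) / e))"
          by (intro ereal_less_eq(3)[THEN iffD2] add_left_mono mult_left_mono lnT) simp
        also have "\<dots> = ln_enat (covering_number_sup (space P) (e powr q) \<Lambda>) + ereal (C1 / e)"
          using cA by (simp add: A(3) ln_enat_def C1_def)
        finally show ?thesis .
      qed
    qed
  qed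
  show ?thesis
    by (intro exI[of _ C1] exI[of _ C2] conjI C1 C2(3) allI impI, elim conjE, rule main) auto
qed

end
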